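(* Let $H\le F$ be an extension of free groups and let $\mathcal{E}$ be a set of equations. There exists a least $\mathcal{E}$-closed subgroup of $F$ containing $H$, denoted $\mathrm{cl}_{\mathcal{E}}(H)$ and called the $\mathcal{E}$-closure of $H$. Moreover, the extension $H\le\mathrm{cl}_{\mathcal{E}}(H)$ is algebraic. If in addition $H$ is finitely generated, then the extension $H\le \mathrm{cl}_{\mathcal{E}}(H)$ is e-algebraic, $\mathrm{rk}(\mathrm{cl}_{\mathcal{E}}(H))\le\mathrm{rk}(H)$, and there exists a finite subset $\mathcal{E}_0$ of $\mathcal{E}$ such that $\mathrm{cl}_{\mathcal{E}_0}(H)=\mathrm{cl}_{\mathcal{E}}(H)$.
   Context: An equation is an element $e$ of the free group on a countable set of variables $X,Y_1,Y_2,\ldots$. Given a subgroup $H\le F$, a particularization of $e$ over $H$ is the element $e(X,h_1,h_2,\ldots)$ of $H*\langle X\rangle$ (free product with the infinite cyclic group on $X$) obtained by substituting elements $h_1,h_2,\ldots\in H$ for $Y_1,Y_2,\ldots$; it is non-trivial if it is $\neq 1$ in $H*\langle X\rangle$. A solution of $e$ over $H$ is an element $x\in F$ such that for some $h_1,h_2,\ldots\in H$ one has $e(X,h_1,h_2,\ldots)\neq 1$ in $H*\langle X\rangle$ but $e(x,h_1,h_2,\ldots)=1$ in $F$. For a set $\mathcal{E}$ of equations, $H$ is $\mathcal{E}$-closed if $H$ contains every solution over $H$ of every equation in $\mathcal{E}$ (the equations are considered individually, not as a system). $\mathrm{rk}$ denotes rank. A subgroup $L$ of $K$ is a free factor of $K$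 if $K=L*M$ for some $M\le K$. For free groups $H\le K$, the extension $H\le K$ is algebraic if every $x\in K$ lies in every free factor of $K$ containing $H$; it is elementary if $K=\langle H,x\rangle$ for some $x\in K$; it is e-algebraic if it is a finite composition $H\le H_1\le\cdots\le H_k=K$ of extensions each of which is both elementary and algebraic. *)

theory Defs
  imports "HOL-Algebra.Elementary_Groups"
begin

unbundle cardinal_syntax

section \<open>Free groups\<close>

text \<open>The letter \<open>(x, True)\<close> stands for \<open>x\<close> and \<open>(x, False)\<close> for its inverse.\<close>

definition cancelling :: "'x \<times> bool \<Rightarrow> 'x \<times> bool \<Rightarrow> bool" where
  "cancelling a b \<longleftrightarrow> fst a = fst b \<and> snd a \<noteq> snd b"

definition red_cons :: "'x \<times> bool \<Rightarrow> ('x \<times> bool) list \<Rightarrow> ('x \<times> bool) list" where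
  "red_cons a w = (case w of [] \<Rightarrow> [a] | b # v \<Rightarrow> if cancelling a b then v else a # w)"

text \<open>Reduced words over \<open>S\<close>, multiplied by concatenation followed by free reduction.\<close>

definition free_group :: "'x set \<Rightarrow> ('x \<times> bool) list monoid" where
  "free_group S =
    \<lparr>carrier = {w. fst ` set w \<subseteq> S \<and> successively (\<lambda>a b. \<not> cancelling a b) w},
     monoid.mult = (\<lambda>u v. foldr red_cons u v),
     one = []\<rparr>"

definition word_eval :: "('a, 'b) monoid_scheme \<Rightarrow> ('x \<Rightarrow> 'a) \<Rightarrow> ('x \<times> bool) list \<Rightarrow> 'a" where
  "word_eval G \<phi> w =
    foldr (\<lambda>(x, b) u. (if b then \<phi> x else inv\<^bsub>G\<^esub> (\<phi> x)) \<otimes>\<^bsub>G\<^esub> u) w \<one>\<^bsub>G\<^esub>"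

definition free_basis :: "('a, 'b) monoid_scheme \<Rightarrow> 'a set \<Rightarrow> bool" where
  "free_basis G B \<longleftrightarrow> B \<subseteq> carrier G \<and> word_eval G (\<lambda>b. b) \<in> iso (free_group B) G"

definition is_free_group :: "('a, 'b) monoid_scheme \<Rightarrow> bool" where
  "is_free_group G \<longleftrightarrow> group G \<and> (\<exists>B. free_basis G B)"

text \<open>The rank of a free group as a cardinal, to be compared with \<open>\<le>o\<close>; it is
  meaningful only if \<open>is_free_group G\<close>.\<close>

definition free_rank :: "('a, 'b) monoid_scheme \<Rightarrow> 'a rel" where
  "free_rank G = |SOME B. free_basis G B|"


section \<open>Free products\<close>

definition fp_inl :: "('a, 'c) monoid_scheme \<Rightarrow> 'a \<Rightarrow> ('a + 'b) list" where
  "fp_inl G g = (if g = \<one>\<^bsub>G\<^esub> then [] else [Inl g])"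

definition fp_inr :: "('b, 'd) monoid_scheme \<Rightarrow> 'b \<Rightarrow> ('a + 'b) list" where
  "fp_inr H h = (if h = \<one>\<^bsub>H\<^esub> then [] else [Inr h])"

fun fp_cons ::
  "('a, 'c) monoid_scheme \<Rightarrow> ('b, 'd) monoid_scheme \<Rightarrow> 'a + 'b \<Rightarrow> ('a + 'b) list \<Rightarrow> ('a + 'b) list"
where
  "fp_cons G H (Inl g) (Inl g' # w) = fp_inl G (g \<otimes>\<^bsub>G\<^esub> g') @ w"
| "fp_cons G H (Inr h) (Inr h' # w) = fp_inr H (h \<otimes>\<^bsub>H\<^esub> h') @ w"
| "fp_cons G H (Inl g) w = fp_inl G g @ w"
| "fp_cons G H (Inr h) w = fp_inr H h @ w"

text \<open>Normal forms: words of non-trivial elements coming alternately from the two factors.\<close>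

definition free_product ::
  "('a, 'c) monoid_scheme \<Rightarrow> ('b, 'd) monoid_scheme \<Rightarrow> ('a + 'b) list monoid"
where
  "free_product G H =
    \<lparr>carrier = {w. set w \<subseteq> Inl ` (carrier G - {\<one>\<^bsub>G\<^esub>}) \<union> Inr ` (carrier H - {\<one>\<^bsub>H\<^esub>})
                 \<and> successively (\<lambda>a b. isl a \<noteq> isl b) w},
     monoid.mult = (\<lambda>u v. foldr (fp_cons G H) u v),
     one = []\<rparr>"

definition fp_eval :: "('a, 'b) monoid_scheme \<Rightarrow> ('a + 'a) list \<Rightarrow> 'a" where
  "fp_eval G w = foldr (\<lambda>a u. case_sum (\<lambda>g. g) (\<lambda>h. h) a \<otimes>\<^bsub>G\<^esub> u) w \<one>\<^bsub>G\<^esub>"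

definition internal_free_product :: "('a, 'b) monoid_scheme \<Rightarrow> 'a set \<Rightarrow> 'a set \<Rightarrow> bool" where
  "internal_free_product K L M \<longleftrightarrow> subgroup L K \<and> subgroup M K \<and>
     fp_eval K \<in> iso (free_product (K\<lparr>carrier := L\<rparr>) (K\<lparr>carrier := M\<rparr>)) K"

definition free_factor :: "'a set \<Rightarrow> ('a, 'b) monoid_scheme \<Rightarrow> bool" where
  "free_factor L K \<longleftrightarrow> (\<exists>M. internal_free_product K L M)"


section \<open>Extensions inside an ambient group\<close>

definition extension :: "('a, 'b) monoid_scheme \<Rightarrow> 'a set \<Rightarrow> 'a set \<Rightarrow> bool" where
  "extension F H K \<longleftrightarrow> subgroup H F \<and> subgroup K F \<and> H \<subseteq> K"

definition algebraic_ext :: "('a, 'b) monoid_scheme \<Rightarrow> 'a set \<Rightarrow> 'a set \<Rightarrow> bool" where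
  "algebraic_ext F H K \<longleftrightarrow> extension F H K \<and>
     (\<forall>x\<in>K. \<forall>L. free_factor L (F\<lparr>carrier := K\<rparr>) \<and> H \<subseteq> L \<longrightarrow> x \<in> L)"

definition elementary_ext :: "('a, 'b) monoid_scheme \<Rightarrow> 'a set \<Rightarrow> 'a set \<Rightarrow> bool" where
  "elementary_ext F H K \<longleftrightarrow> extension F H K \<and> (\<exists>x\<in>K. K = generate F (insert x H))"

text \<open>The empty composition is harmless: \<open>H \<le> H\<close> is itself elementary and algebraic.\<close>

definition e_algebraic_ext :: "('a, 'b) monoid_scheme \<Rightarrow> 'a set \<Rightarrow> 'a set \<Rightarrow> bool" where
  "e_algebraic_ext F H K \<longleftrightarrow>
     (\<exists>(k::nat) C. C 0 = H \<and> C k = K \<and>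
        (\<forall>i<k. elementary_ext F (C i) (C (Suc i)) \<and> algebraic_ext F (C i) (C (Suc i))))"

definition fin_gen_subgroup :: "('a, 'b) monoid_scheme \<Rightarrow> 'a set \<Rightarrow> bool" where
  "fin_gen_subgroup F H \<longleftrightarrow> (\<exists>S. finite S \<and> S \<subseteq> carrier F \<and> H = generate F S)"


section \<open>Equations\<close>

datatype eq_var = VarX | VarY nat

type_synonym equation = "(eq_var \<times> bool) list"

definition equations :: "equation set" where
  "equations = carrier (free_group UNIV)"

definition subst_var :: "'a \<Rightarrow> (nat \<Rightarrow> 'a) \<Rightarrow> eq_var \<Rightarrow> 'a" where
  "subst_var x h v = (case v of VarX \<Rightarrow> x | VarY i \<Rightarrow> h i)"

text \<open>\<open>H * \<langle>X\<rangle>\<close>, with \<open>X\<close> the generator \<open>1\<close> of the infinite cyclic group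
  \<open>integer_group\<close>.\<close>

definition adjoin_var :: "('a, 'b) monoid_scheme \<Rightarrow> 'a set \<Rightarrow> ('a + int) list monoid" where
  "adjoin_var F H = free_product (F\<lparr>carrier := H\<rparr>) integer_group"

definition particularization ::
  "('a, 'b) monoid_scheme \<Rightarrow> 'a set \<Rightarrow> equation \<Rightarrow> (nat \<Rightarrow> 'a) \<Rightarrow> ('a + int) list"
where
  "particularization F H e h =
     word_eval (adjoin_var F H) (subst_var (fp_inr integer_group 1) (\<lambda>i. fp_inl F (h i))) e"

definition solution_over :: "('a, 'b) monoid_scheme \<Rightarrow> 'a set \<Rightarrow> equation \<Rightarrow> 'a \<Rightarrow> bool" where
  "solution_over F H e x \<longleftrightarrow> x \<in> carrier F \<and>
     (\<exists>h. (\<forall>i. h i \<in> H) \<and>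
          particularization F H e h \<noteq> \<one>\<^bsub>adjoin_var F H\<^esub> \<and>
          word_eval F (subst_var x h) e = \<one>\<^bsub>F\<^esub>)"

definition e_closed :: "('a, 'b) monoid_scheme \<Rightarrow> equation set \<Rightarrow> 'a set \<Rightarrow> bool" where
  "e_closed F E H \<longleftrightarrow> subgroup H F \<and> (\<forall>e\<in>E. \<forall>x. solution_over F H e x \<longrightarrow> x \<in> H)"

definition e_closure :: "('a, 'b) monoid_scheme \<Rightarrow> equation set \<Rightarrow> 'a set \<Rightarrow> 'a set" where
  "e_closure F E H = (LEAST K. e_closed F E K \<and> H \<subseteq> K)"


section \<open>The constructions are groups and evaluation is a homomorphism\<close>

lemma red_cons_red:
  "successively (\<lambda>a b. \<not> cancelling a b) w \<Longrightarrow> successively (\<lambda>a b. \<not> cancelling a b) (red_cons a w)"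
  by (auto simp: red_cons_def successively_Cons split: list.splits)

lemma red_cons_set: "fst ` set (red_cons a w) \<subseteq> insert (fst a) (fst ` set w)"
  by (auto simp: red_cons_def split: list.splits)

lemma red_cons_cancel:
  assumes "successively (\<lambda>a b. \<not> cancelling a b) w" "cancelling a b"
  shows "red_cons a (red_cons b w) = w"
proof (cases w)
  case Nil
  then show ?thesis using assms(2) by (simp add: red_cons_def)
next
  case (Cons c v)
  show ?thesis
  proof (cases "cancelling b c")
    case True
    then have "c = a" using assms(2) by (cases a; cases b; cases c) (auto simp: cancelling_def)
    then show ?thesis using assms(1) Cons True
      by (cases v) (auto simp: red_cons_def)
  next
    case False
    then show ?thesis using assms(2) Cons by (simp add: red_cons_def)
  qed
qed

lemma foldr_red_cons_red:
  "successively (\<lambda>a b. \<not> cancelling a b) w \<Longrightarrow>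
   successively (\<lambda>a b. \<not> cancelling a b) (foldr red_cons u w)"
  by (induction u) (auto intro: red_cons_red)

lemma foldr_red_cons_set: "fst ` set (foldr red_cons u w) \<subseteq> fst ` set u \<union> fst ` set w"
proof (induction u)
  case (Cons a u)
  show ?case using subset_trans[OF red_cons_set[of a "foldr red_cons u w"] insert_mono[OF Cons.IH]]
    by simp
qed simp

lemma foldr_red_cons_assoc:
  assumes w: "successively (\<lambda>a b. \<not> cancelling a b) w"
    and v: "successively (\<lambda>a b. \<not> cancelling a b) v"
  shows "foldr red_cons (foldr red_cons u v) w = foldr red_cons u (foldr red_cons v w)"
proof (induction u)
  case (Cons a u)
  have *: "foldr red_cons (red_cons a x) w = red_cons a (foldr red_cons x w)" for x
    using red_cons_cancel[OF foldr_red_cons_red[OF w], of a]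
    by (auto simp: red_cons_def[of a x] split: list.splits)
  show ?case by (simp add: * Cons.IH)
qed simp

lemma foldr_red_cons_Nil:
  "successively (\<lambda>a b. \<not> cancelling a b) w \<Longrightarrow> foldr red_cons w [] = w"
  by (induction w) (auto simp: red_cons_def successively_Cons split: list.splits)

lemma group_free_group: "group (free_group S)"
proof (rule groupI)
  fix x assume x: "x \<in> carrier (free_group S)"
  define y where "y = foldr red_cons (rev (map (\<lambda>(a, b). (a, \<not> b)) x)) []"
  have ex: "foldr red_cons (rev (map (\<lambda>(a, b). (a, \<not> b)) x)) (foldr red_cons x []) = []"
  proof (induction x)
    case (Cons a x)
    have "red_cons (fst a, \<not> snd a) (red_cons a (foldr red_cons x [])) = foldr red_cons x []"
      by (intro red_cons_cancel foldr_red_cons_red) (auto simp: cancelling_def)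
    then show ?case using Cons by (simp add: case_prod_beta)
  qed simp
  have "y \<in> carrier (free_group S)"
  proof -
    have "fst ` set (rev (map (\<lambda>(a, b). (a, \<not> b)) x)) = fst ` set x"
      by (simp add: image_image case_prod_beta)
    then have "fst ` set y \<subseteq> S"
      using x foldr_red_cons_set[of "rev (map (\<lambda>(a, b). (a, \<not> b)) x)" "[]"]
      unfolding y_def free_group_def by simp (elim conjE, erule (1) subset_trans)
    then show ?thesis by (simp add: free_group_def y_def foldr_red_cons_red)
  qed
  moreover have "y \<otimes>\<^bsub>free_group S\<^esub> x = \<one>\<^bsub>free_group S\<^esub>"
    using x ex by (simp add: free_group_def y_def foldr_red_cons_assoc foldr_red_cons_Nil)
  ultimately show "\<exists>y\<in>carrier (free_group S). y \<otimes>\<^bsub>free_group S\<^esub> x = \<one>\<^bsub>free_group S\<^esub>" by blast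
next
  fix x y assume "x \<in> carrier (free_group S)" "y \<in> carrier (free_group S)"
  then show "x \<otimes>\<^bsub>free_group S\<^esub> y \<in> carrier (free_group S)"
    using subset_trans[OF foldr_red_cons_set[of x y] Un_least]
    by (simp add: free_group_def foldr_red_cons_red)
qed (auto simp: free_group_def foldr_red_cons_assoc)

lemma (in group) word_eval_closed:
  "\<phi> ` fst ` set w \<subseteq> carrier G \<Longrightarrow> word_eval G \<phi> w \<in> carrier G"
  by (induction w) (auto simp: word_eval_def)

lemma (in group) word_eval_red_cons:
  assumes "\<phi> (fst a) \<in> carrier G" "\<phi> ` fst ` set w \<subseteq> carrier G"
  shows "word_eval G \<phi> (red_cons a w) = word_eval G \<phi> (a # w)"
proof (cases w)
  case (Cons b v)
  have "word_eval G \<phi> v \<in> carrier G" using assms Cons by (auto intro: word_eval_closed)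
  then show ?thesis using assms Cons
    by (cases a; cases b) (auto simp: red_cons_def cancelling_def word_eval_def m_assoc[symmetric])
qed (simp add: red_cons_def)

lemma (in group) word_eval_hom:
  fixes S :: "'x set"
  assumes "\<phi> \<in> S \<rightarrow> carrier G"
  shows "word_eval G \<phi> \<in> hom (free_group S) G"
proof (rule homI)
  have im: "\<phi> ` fst ` set x \<subseteq> carrier G" if "fst ` set x \<subseteq> S" for x :: "('x \<times> bool) list"
    using assms that by blast
  show "word_eval G \<phi> x \<in> carrier G" if "x \<in> carrier (free_group S)" for x
    using that by (intro word_eval_closed im) (simp add: free_group_def)
  fix x y assume xy: "x \<in> carrier (free_group S)" "y \<in> carrier (free_group S)"
  have "word_eval G \<phi> (foldr red_cons x y) = word_eval G \<phi> x \<otimes> word_eval G \<phi> y"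
    if "fst ` set x \<subseteq> S" using that
  proof (induction x)
    case Nil
    have "word_eval G \<phi> y \<in> carrier G" using xy by (intro word_eval_closed im) (simp add: free_group_def)
    then show ?case by (simp add: word_eval_def)
  next
    case (Cons a x)
    have y: "fst ` set y \<subseteq> S" using xy by (simp add: free_group_def)
    have "fst ` set (foldr red_cons x y) \<subseteq> S"
      using subset_trans[OF foldr_red_cons_set[of x y] Un_least] Cons.prems y by simp
    then have "word_eval G \<phi> (red_cons a (foldr red_cons x y)) = word_eval G \<phi> (a # foldr red_cons x y)"
      using Cons.prems assms by (intro word_eval_red_cons im) auto
    moreover have "word_eval G \<phi> x \<in> carrier G" "word_eval G \<phi> y \<in> carrier G" "\<phi> (fst a) \<in> carrier G"
      using Cons.prems y assms by (auto intro!: word_eval_closed)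
    ultimately show ?case
      using Cons by (cases a) (simp add: word_eval_def m_assoc)
  qed
  then show "word_eval G \<phi> (x \<otimes>\<^bsub>free_group S\<^esub> y) = word_eval G \<phi> x \<otimes> word_eval G \<phi> y"
    using xy by (simp add: free_group_def)
qed


lemma fp_cons_simps:
  "fp_cons G H (Inl g) w =
    (case w of Inl g' # v \<Rightarrow> fp_inl G (g \<otimes>\<^bsub>G\<^esub> g') @ v | _ \<Rightarrow> fp_inl G g @ w)"
  "fp_cons G H (Inr h) w =
    (case w of Inr h' # v \<Rightarrow> fp_inr H (h \<otimes>\<^bsub>H\<^esub> h') @ v | _ \<Rightarrow> fp_inr H h @ w)"
  by (auto split: list.splits sum.splits)

context
  fixes G :: "('a, 'c) monoid_scheme" and H :: "('b, 'd) monoid_scheme"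
  assumes G: "group G" and H: "group H"
begin

interpretation G: group G by (rule G)
interpretation H: group H by (rule H)

lemma fp_cons_closed:
  assumes "w \<in> carrier (free_product G H)" "a \<in> Inl ` carrier G \<union> Inr ` carrier H"
  shows "fp_cons G H a w \<in> carrier (free_product G H)"
proof (cases w)
  case Nil
  then show ?thesis using assms by (auto simp: free_product_def fp_inl_def fp_inr_def split: if_splits)
next
  case (Cons b v)
  then show ?thesis using assms
    by (cases a; cases b) (auto simp: free_product_def fp_inl_def fp_inr_def successively_Cons)
qed

lemma fp_cons_one:
  assumes "w \<in> carrier (free_product G H)"
  shows "fp_cons G H (Inl \<one>\<^bsub>G\<^esub>) w = w" "fp_cons G H (Inr \<one>\<^bsub>H\<^esub>) w = w"
  using assms
  by (auto simp: free_product_def fp_cons_simps fp_inl_def fp_inr_def split: list.splits sum.splits)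

lemma fp_cons_mult:
  assumes "w \<in> carrier (free_product G H)"
  shows "g \<in> carrier G \<Longrightarrow> g' \<in> carrier G \<Longrightarrow>
      fp_cons G H (Inl g) (fp_cons G H (Inl g') w) = fp_cons G H (Inl (g \<otimes>\<^bsub>G\<^esub> g')) w"
    and "h \<in> carrier H \<Longrightarrow> h' \<in> carrier H \<Longrightarrow>
      fp_cons G H (Inr h) (fp_cons G H (Inr h') w) = fp_cons G H (Inr (h \<otimes>\<^bsub>H\<^esub> h')) w"
proof -
  assume g: "g \<in> carrier G" "g' \<in> carrier G"
  show "fp_cons G H (Inl g) (fp_cons G H (Inl g') w) = fp_cons G H (Inl (g \<otimes>\<^bsub>G\<^esub> g')) w"
  proof (cases "\<exists>k v. w = Inl k # v")
    case True
    then obtain k v where w: "w = Inl k # v" by blast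
    have k: "k \<in> carrier G" and v: "\<And>l u. v \<noteq> Inl l # u"
      using assms w by (auto simp: free_product_def)
    show ?thesis
    proof (cases "g' \<otimes>\<^bsub>G\<^esub> k = \<one>\<^bsub>G\<^esub>")
      case one: True
      then have "g \<otimes>\<^bsub>G\<^esub> g' \<otimes>\<^bsub>G\<^esub> k = g" using g k by (simp add: G.m_assoc)
      then show ?thesis using v one w
        by (auto simp: fp_cons_simps(1) fp_inl_def split: list.splits sum.splits)
    next
      case False
      then show ?thesis using g k w by (simp add: fp_inl_def G.m_assoc)
    qed
  next
    case False
    then have "fp_cons G H (Inl x) w = fp_inl G x @ w" for x
      by (auto simp: fp_cons_simps(1) split: list.splits sum.splits)
    then show ?thesis using g by (auto simp: fp_inl_def)
  qed
next
  assume h: "h \<in> carrier H" "h' \<in> carrier H"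
  show "fp_cons G H (Inr h) (fp_cons G H (Inr h') w) = fp_cons G H (Inr (h \<otimes>\<^bsub>H\<^esub> h')) w"
  proof (cases "\<exists>k v. w = Inr k # v")
    case True
    then obtain k v where w: "w = Inr k # v" by blast
    have k: "k \<in> carrier H" and v: "\<And>l u. v \<noteq> Inr l # u"
      using assms w by (auto simp: free_product_def)
    show ?thesis
    proof (cases "h' \<otimes>\<^bsub>H\<^esub> k = \<one>\<^bsub>H\<^esub>")
      case one: True
      then have "h \<otimes>\<^bsub>H\<^esub> h' \<otimes>\<^bsub>H\<^esub> k = h" using h k by (simp add: H.m_assoc)
      then show ?thesis using v one w
        by (auto simp: fp_cons_simps(2) fp_inr_def split: list.splits sum.splits)
    next
      case False
      then show ?thesis using h k w by (simp add: fp_inr_def H.m_assoc)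
    qed
  next
    case False
    then have "fp_cons G H (Inr x) w = fp_inr H x @ w" for x
      by (auto simp: fp_cons_simps(2) split: list.splits sum.splits)
    then show ?thesis using h by (auto simp: fp_inr_def)
  qed
qed

lemma foldr_fp_cons_closed:
  "w \<in> carrier (free_product G H) \<Longrightarrow> set u \<subseteq> Inl ` carrier G \<union> Inr ` carrier H \<Longrightarrow>
   foldr (fp_cons G H) u w \<in> carrier (free_product G H)"
proof (induction u)
  case (Cons a u)
  then show ?case using fp_cons_closed by simp
qed simp

lemma free_product_set:
  "w \<in> carrier (free_product G H) \<Longrightarrow> set w \<subseteq> Inl ` carrier G \<union> Inr ` carrier H"
  by (auto simp: free_product_def)

lemma foldr_fp_cons_step:
  assumes w: "w \<in> carrier (free_product G H)" and x: "x \<in> carrier (free_product G H)"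
    and a: "a \<in> Inl ` carrier G \<union> Inr ` carrier H"
  shows "foldr (fp_cons G H) (fp_cons G H a x) w = fp_cons G H a (foldr (fp_cons G H) x w)"
proof -
  have inl: "foldr (fp_cons G H) (fp_inl G g @ y) w = fp_cons G H (Inl g) (foldr (fp_cons G H) y w)"
    and inr: "foldr (fp_cons G H) (fp_inr H h @ y) w = fp_cons G H (Inr h) (foldr (fp_cons G H) y w)"
    if "set y \<subseteq> Inl ` carrier G \<union> Inr ` carrier H" for g h y
    using foldr_fp_cons_closed[OF w that] fp_cons_one by (simp_all add: fp_inl_def fp_inr_def)
  have sx: "set x \<subseteq> Inl ` carrier G \<union> Inr ` carrier H" by (rule free_product_set[OF x])
  show ?thesis
  proof (cases a)
    case (Inl g)
    show ?thesis
    proof (cases "\<exists>k v. x = Inl k # v")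
      case True
      then obtain k v where x': "x = Inl k # v" by blast
      have v: "set v \<subseteq> Inl ` carrier G \<union> Inr ` carrier H" and k: "k \<in> carrier G" and g: "g \<in> carrier G"
        using sx x' Inl a by auto
      show ?thesis
        using fp_cons_mult(1)[OF foldr_fp_cons_closed[OF w v] g k] inl[OF v] x' Inl by simp
    next
      case False
      then have "fp_cons G H (Inl g) x = fp_inl G g @ x"
        by (auto simp: fp_cons_simps(1) split: list.splits sum.splits)
      then show ?thesis using inl[OF sx] Inl by simp
    qed
  next
    case (Inr h)
    show ?thesis
    proof (cases "\<exists>k v. x = Inr k # v")
      case True
      then obtain k v where x': "x = Inr k # v" by blast
      have v: "set v \<subseteq> Inl ` carrier G \<union> Inr ` carrier H" and k: "k \<in> carrier H" and h: "h \<in> carrier H"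
        using sx x' Inr a by auto
      show ?thesis
        using fp_cons_mult(2)[OF foldr_fp_cons_closed[OF w v] h k] inr[OF v] x' Inr by simp
    next
      case False
      then have "fp_cons G H (Inr h) x = fp_inr H h @ x"
        by (auto simp: fp_cons_simps(2) split: list.splits sum.splits)
      then show ?thesis using inr[OF sx] Inr by simp
    qed
  qed
qed

lemma foldr_fp_cons_assoc:
  assumes "w \<in> carrier (free_product G H)" "v \<in> carrier (free_product G H)"
    and "set u \<subseteq> Inl ` carrier G \<union> Inr ` carrier H"
  shows "foldr (fp_cons G H) (foldr (fp_cons G H) u v) w =
    foldr (fp_cons G H) u (foldr (fp_cons G H) v w)"
  using assms(3)
proof (induction u)
  case (Cons a u)
  then show ?case
    using foldr_fp_cons_step[OF assms(1) foldr_fp_cons_closed[OF assms(2)], of u a] by simp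
qed simp

lemma foldr_fp_cons_Nil:
  assumes "w \<in> carrier (free_product G H)"
  shows "foldr (fp_cons G H) w [] = w"
  using assms
proof (induction w)
  case (Cons a w)
  then have "foldr (fp_cons G H) w [] = w"
    by (auto simp: free_product_def successively_Cons)
  then show ?case using Cons.prems
    by (cases a; cases w; cases "hd w")
      (auto simp: free_product_def successively_Cons fp_inl_def fp_inr_def)
qed simp

lemma group_free_product: "group (free_product G H)"
proof (rule groupI)
  have N: "[] \<in> carrier (free_product G H)" by (simp add: free_product_def)
  then show "\<one>\<^bsub>free_product G H\<^esub> \<in> carrier (free_product G H)" by (simp add: free_product_def)
  fix x assume x: "x \<in> carrier (free_product G H)"
  define iv where "iv = map_sum (\<lambda>g. inv\<^bsub>G\<^esub> g) (\<lambda>h. inv\<^bsub>H\<^esub> h)"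
  define y where "y = foldr (fp_cons G H) (rev (map iv x)) []"
  have s: "set (rev (map iv x)) \<subseteq> Inl ` carrier G \<union> Inr ` carrier H"
    using free_product_set[OF x] by (auto simp: iv_def)
  have ex: "foldr (fp_cons G H) (rev (map iv x)) (foldr (fp_cons G H) x []) = []"
    using free_product_set[OF x]
  proof (induction x)
    case (Cons a x)
    have c: "foldr (fp_cons G H) x [] \<in> carrier (free_product G H)"
      using Cons.prems by (intro foldr_fp_cons_closed N) auto
    have "fp_cons G H (iv a) (fp_cons G H a (foldr (fp_cons G H) x [])) = foldr (fp_cons G H) x []"
      using Cons.prems fp_cons_mult[OF c] fp_cons_one[OF c] by (cases a) (auto simp: iv_def)
    then show ?case using Cons by simp
  qed simp
  have "y \<in> carrier (free_product G H)" unfolding y_def by (intro foldr_fp_cons_closed N s)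
  moreover have "foldr (fp_cons G H) y x = []"
    unfolding y_def using foldr_fp_cons_assoc[OF x N s] ex foldr_fp_cons_Nil[OF x] by simp
  ultimately show "\<exists>y\<in>carrier (free_product G H). y \<otimes>\<^bsub>free_product G H\<^esub> x = \<one>\<^bsub>free_product G H\<^esub>"
    by (auto simp: free_product_def)
next
  fix x y assume "x \<in> carrier (free_product G H)" "y \<in> carrier (free_product G H)"
  then show "x \<otimes>\<^bsub>free_product G H\<^esub> y \<in> carrier (free_product G H)"
    using foldr_fp_cons_closed[OF _ free_product_set] by (simp add: free_product_def)
next
  fix x y z
  assume "x \<in> carrier (free_product G H)" "y \<in> carrier (free_product G H)"
    "z \<in> carrier (free_product G H)"
  then show "x \<otimes>\<^bsub>free_product G H\<^esub> y \<otimes>\<^bsub>free_product G H\<^esub> z =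
      x \<otimes>\<^bsub>free_product G H\<^esub> (y \<otimes>\<^bsub>free_product G H\<^esub> z)"
    using foldr_fp_cons_assoc[OF _ _ free_product_set] by (simp add: free_product_def)
qed (simp add: free_product_def)

lemma fp_inl_hom: "fp_inl G \<in> hom G (free_product G H)"
  by (rule homI) (auto simp: fp_inl_def free_product_def)

lemma fp_inr_hom: "fp_inr H \<in> hom H (free_product G H)"
  by (rule homI) (auto simp: fp_inr_def free_product_def)

end

lemma (in group) fp_eval_hom:
  assumes L: "subgroup L G" and M: "subgroup M G"
  shows "fp_eval G \<in> hom (free_product (G\<lparr>carrier := L\<rparr>) (G\<lparr>carrier := M\<rparr>)) G"
proof (rule homI)
  let ?P = "free_product (G\<lparr>carrier := L\<rparr>) (G\<lparr>carrier := M\<rparr>)"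
  let ?L = "G\<lparr>carrier := L\<rparr>" and ?M = "G\<lparr>carrier := M\<rparr>"
  have grp: "group ?L" "group ?M"
    using L M by (auto intro: subgroup.subgroup_is_group)
  have sub: "L \<subseteq> carrier G" "M \<subseteq> carrier G" using L M by (auto dest: subgroup.subset)
  have cl: "fp_eval G w \<in> carrier G" if "set w \<subseteq> Inl ` L \<union> Inr ` M" for w
    using that sub by (induction w) (auto simp: fp_eval_def)
  have st: "set w \<subseteq> Inl ` L \<union> Inr ` M" if "w \<in> carrier ?P" for w
    using free_product_set[OF grp that] by simp
  show "fp_eval G x \<in> carrier G" if "x \<in> carrier ?P" for x using cl[OF st[OF that]] .
  have step: "fp_eval G (fp_cons ?L ?M a w) = fp_eval G (a # w)"
    if "a \<in> Inl ` L \<union> Inr ` M" "set w \<subseteq> Inl ` L \<union> Inr ` M" for a w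
  proof -
    have "fp_eval G (tl w) \<in> carrier G" using that(2) by (intro cl) (cases w; auto)
    then show ?thesis using that sub cl[OF that(2)]
      by (cases a; cases w; cases "hd w")
        (auto simp: fp_eval_def fp_inl_def fp_inr_def m_assoc[symmetric] subset_iff)
  qed
  fix x y assume xy: "x \<in> carrier ?P" "y \<in> carrier ?P"
  have "fp_eval G (foldr (fp_cons ?L ?M) x y) = fp_eval G x \<otimes> fp_eval G y"
    if "set x \<subseteq> Inl ` L \<union> Inr ` M" using that
  proof (induction x)
    case Nil
    then show ?case using cl[OF st[OF xy(2)]] by (simp add: fp_eval_def)
  next
    case (Cons a x)
    have "foldr (fp_cons ?L ?M) x y \<in> carrier ?P"
      using Cons.prems xy by (intro foldr_fp_cons_closed grp) auto
    then have "fp_eval G (foldr (fp_cons ?L ?M) (a # x) y) =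
        fp_eval G (a # foldr (fp_cons ?L ?M) x y)"
      using step st Cons.prems by simp
    moreover have "fp_eval G x \<in> carrier G" "fp_eval G y \<in> carrier G"
      using Cons.prems cl st[OF xy(2)] by auto
    moreover have "case_sum (\<lambda>g. g) (\<lambda>h. h) a \<in> carrier G" using Cons.prems sub by auto
    ultimately show ?case using Cons by (simp add: fp_eval_def m_assoc)
  qed
  then show "fp_eval G (x \<otimes>\<^bsub>?P\<^esub> y) = fp_eval G x \<otimes> fp_eval G y"
    using st[OF xy(1)] by (simp add: free_product_def)
qed

end

theory Submission
  imports Defs "HOL-Algebra.Bij"
begin

text \<open>If \<open>K = L * M\<close> is torsion-free and \<open>x \<in> K - L\<close>, then \<open>x\<close> solves no non-trivial equation
  over \<open>L\<close>: after an automorphism \<open>X \<mapsto> l1 X l2\<close> of \<open>L * \<langle>X\<rangle>\<close> the normal form of \<open>x\<close> begins and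
  ends in \<open>M\<close>, and so do those of its powers. Hence free factors containing \<open>H\<close> absorb solutions,
  which makes the closure, and every extension \<open>K \<le> \<langle>K, x\<rangle>\<close> by a solution \<open>x\<close>, algebraic.

  For finitely generated \<open>H\<close>, solutions are adjoined one at a time. The rank does not increase, since
  otherwise the relation satisfied by \<open>x\<close> would be a law in every finite group, against residual
  finiteness of free groups. The process stops: by Nielsen--Schreier the union of an infinite strictly
  ascending chain of subgroups has an infinite basis, but a finite part of it lies in a member of
  the chain, and counting homomorphisms to \<open>\<int>/2\<close> bounds its size by the rank of that member.\<close>

section \<open>Evaluation of words and free bases\<close>

text \<open>\<open>free_rank\<close> is the size of a basis picked by \<open>SOME\<close>, so
  invariance of rank is not there to start from. Rank bounds are carried as sizes of generating sets
  and converted into bounds on bases by counting: homomorphisms are determined on any generating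
  set, while a basis with n elements gives \<open>card Q ^ n\<close> of them into a finite group Q.
  If a generating set has n elements as well, restriction to it is onto, so its elements can be sent
  anywhere in Q. This does the work of the Hopf property: the generators are not recognised as a
  basis, but no finite group can tell them from one, and residual finiteness turns that into a
  contradiction with any relation among them.

  On the algebraic side the obstacle is cancellation when x replaces X in a normal form over L:
  syllables of x lying in L may merge with coefficients, and powers of x may collapse. The shift by
  l1 and l2 removes the first danger, torsion-freeness the second.

  The finite set of equations comes from the process that adjoins solutions: each step spends one
  equation, and a solution remains one over every larger subgroup.\<close>

lemma (in group) m_inv_cancel:
  assumes "x \<in> carrier G" "y \<in> carrier G"
  shows "inv x \<otimes> (x \<otimes> y) = y" "x \<otimes> (inv x \<otimes> y) = y"
  using assms by (simp_all add: m_assoc[symmetric])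

lemma word_eval_simps [simp]:
  "word_eval G \<phi> [] = \<one>\<^bsub>G\<^esub>"
  "word_eval G \<phi> ((x, b) # w) = (if b then \<phi> x else inv\<^bsub>G\<^esub> \<phi> x) \<otimes>\<^bsub>G\<^esub> word_eval G \<phi> w"
  by (simp_all add: word_eval_def)

lemma word_eval_cong:
  assumes "\<And>x. x \<in> fst ` set w \<Longrightarrow> \<phi> x = \<psi> x"
  shows "word_eval G \<phi> w = word_eval G \<psi> w"
  using assms by (induction w) auto

lemma hom_word_eval:
  assumes "group G" "group G'" "f \<in> hom G G'" "\<phi> ` fst ` set w \<subseteq> carrier G"
  shows "f (word_eval G \<phi> w) = word_eval G' (\<lambda>x. f (\<phi> x)) w"
proof -
  interpret f: group_hom G G' f
    using assms by (simp add: group_hom_def group_hom_axioms_def)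
  show ?thesis
    using assms(4)
  proof (induction w)
    case (Cons a w)
    then have "word_eval G \<phi> w \<in> carrier G" "\<phi> (fst a) \<in> carrier G"
      by (auto intro!: f.G.word_eval_closed)
    with Cons show ?case by (cases a) auto
  qed simp
qed

lemma (in group) word_eval_subgroup:
  assumes "subgroup K G" "\<phi> ` fst ` set w \<subseteq> K"
  shows "word_eval (G\<lparr>carrier := K\<rparr>) \<phi> w = word_eval G \<phi> w"
proof -
  have "(\<lambda>x. x) \<in> hom (G\<lparr>carrier := K\<rparr>) G"
    using subgroup.subset[OF assms(1)] by (auto simp: hom_def)
  from hom_word_eval[OF subgroup_imp_group[OF assms(1)] is_group this, of \<phi> w] assms(2)
  show ?thesis by simp
qed

lemma (in group) word_eval_in_subgroup:
  assumes "subgroup K G" "\<phi> ` fst ` set w \<subseteq> K"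
  shows "word_eval G \<phi> w \<in> K"
  using group.word_eval_closed[OF subgroup_imp_group[OF assms(1)], of \<phi> w] assms
  by (simp add: word_eval_subgroup)

lemma carrier_free_group:
  "w \<in> carrier (free_group S) \<longleftrightarrow> fst ` set w \<subseteq> S \<and> successively (\<lambda>a b. \<not> cancelling a b) w"
  by (simp add: free_group_def)

lemma one_free_group [simp]: "\<one>\<^bsub>free_group S\<^esub> = []"
  by (simp add: free_group_def)

lemma letter_in_free_group [simp]: "[(x, b)] \<in> carrier (free_group S) \<longleftrightarrow> x \<in> S"
  by (simp add: carrier_free_group)

lemma (in group) word_eval_image:
  assumes "\<phi> \<in> S \<rightarrow> carrier G"
  shows "word_eval G \<phi> ` carrier (free_group S) = generate G (\<phi> ` S)"
proof
  have sub: "\<phi> ` S \<subseteq> carrier G" using assms by auto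
  show "word_eval G \<phi> ` carrier (free_group S) \<subseteq> generate G (\<phi> ` S)"
  proof (rule image_subsetI)
    fix w assume "w \<in> carrier (free_group S)"
    then have "\<phi> ` fst ` set w \<subseteq> generate G (\<phi> ` S)"
      by (auto simp: carrier_free_group intro!: generate.incl)
    then show "word_eval G \<phi> w \<in> generate G (\<phi> ` S)"
      by (rule word_eval_in_subgroup[OF generate_is_subgroup[OF sub]])
  qed
  interpret f: group_hom "free_group S" G "word_eval G \<phi>"
    using word_eval_hom[OF assms] is_group group_free_group[of S]
    by (simp add: group_hom_def group_hom_axioms_def)
  have "\<phi> ` S \<subseteq> word_eval G \<phi> ` carrier (free_group S)"
  proof (rule image_subsetI)
    fix s assume "s \<in> S"
    then show "\<phi> s \<in> word_eval G \<phi> ` carrier (free_group S)"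
      using assms by (intro image_eqI[of _ _ "[(s, True)]"]) (auto simp: Pi_iff)
  qed
  then show "generate G (\<phi> ` S) \<subseteq> word_eval G \<phi> ` carrier (free_group S)"
    using generate_subgroup_incl f.img_is_subgroup by blast
qed

lemma (in group) word_eval_iso:
  assumes "\<phi> \<in> S \<rightarrow> carrier G" "generate G (\<phi> ` S) = carrier G"
    and "\<And>w. w \<in> carrier (free_group S) \<Longrightarrow> word_eval G \<phi> w = \<one> \<Longrightarrow> w = []"
  shows "word_eval G \<phi> \<in> iso (free_group S) G"
proof -
  interpret f: group_hom "free_group S" G "word_eval G \<phi>"
    using word_eval_hom[OF assms(1)] is_group group_free_group[of S]
    by (simp add: group_hom_def group_hom_axioms_def)
  have "inj_on (word_eval G \<phi>) (carrier (free_group S))"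
    using assms(3) by (intro f.trivial_ker_imp_inj) (auto simp: kernel_def carrier_free_group)
  then show ?thesis
    using word_eval_image[OF assms(1)] assms(2) f.homh by (simp add: iso_def bij_betw_def)
qed

text \<open>A section \<open>\<psi>\<close> of \<open>\<phi>\<close> is injective on the image, so a
  reduced word over the image pulls back to a reduced word over \<open>S\<close> with the same
  value.\<close>

lemma (in group) free_basisI:
  assumes \<phi>: "\<phi> \<in> S \<rightarrow> carrier G" and gen: "generate G (\<phi> ` S) = carrier G"
    and triv: "\<And>w. w \<in> carrier (free_group S) \<Longrightarrow> word_eval G \<phi> w = \<one> \<Longrightarrow> w = []"
  shows "free_basis G (\<phi> ` S)"
proof -
  define \<psi> where "\<psi> = inv_into S \<phi>"
  have "w = []" if w: "w \<in> carrier (free_group (\<phi> ` S))" "word_eval G (\<lambda>b. b) w = \<one>" for w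
  proof -
    define v where "v = map (map_prod \<psi> (\<lambda>c. c)) w"
    have set: "fst ` set w \<subseteq> \<phi> ` S" using w by (simp add: carrier_free_group)
    have inj: "inj_on \<psi> (\<phi> ` S)" unfolding \<psi>_def by (rule inj_on_inv_into) simp
    have "fst ` set v = \<psi> ` fst ` set w" by (simp add: v_def image_image)
    then have "fst ` set v \<subseteq> S" using set by (auto simp: \<psi>_def inv_into_into)
    moreover have "successively (\<lambda>a b. \<not> cancelling a b) v"
      using w(1) set unfolding v_def successively_map carrier_free_group
      by (elim conjE successively_mono) (auto simp: cancelling_def inj_on_def dest!: inj_onD[OF inj])
    moreover have "word_eval G \<phi> v = word_eval G (\<lambda>b. b) w"
      using set unfolding v_def
      by (induction w) (auto simp: \<psi>_def f_inv_into_f)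
    ultimately have "v = []" using triv w(2) by (simp add: carrier_free_group)
    then show ?thesis by (simp add: v_def)
  qed
  then show ?thesis
    using \<phi> gen unfolding free_basis_def by (auto intro!: word_eval_iso)
qed

lemma (in group) free_basisD:
  assumes "free_basis G B"
  shows "B \<subseteq> carrier G" "generate G B = carrier G"
    and "\<And>w. w \<in> carrier (free_group B) \<Longrightarrow> word_eval G (\<lambda>b. b) w = \<one> \<Longrightarrow> w = []"
proof -
  show B: "B \<subseteq> carrier G" using assms by (simp add: free_basis_def)
  have iso: "word_eval G (\<lambda>b. b) \<in> iso (free_group B) G" using assms by (simp add: free_basis_def)
  have "word_eval G (\<lambda>b. b) ` carrier (free_group B) = generate G ((\<lambda>b. b) ` B)"
    using B by (intro word_eval_image) auto
  then show "generate G B = carrier G" using iso by (simp add: iso_def bij_betw_def)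
  show "w = []" if "w \<in> carrier (free_group B)" "word_eval G (\<lambda>b. b) w = \<one>" for w
    using iso that inj_onD[of "word_eval G (\<lambda>b. b)" "carrier (free_group B)" w "[]"]
    by (simp add: iso_def bij_betw_def carrier_free_group)
qed

text \<open>The universal property of a basis: read an element as its reduced word, then evaluate
  that word in \<open>G'\<close>.\<close>

lemma (in group) free_basis_extend:
  assumes B: "free_basis G B" and G': "group G'" and \<phi>: "\<phi> \<in> B \<rightarrow> carrier G'"
  shows "\<exists>f\<in>hom G G'. \<forall>b\<in>B. f b = \<phi> b"
proof -
  define e where "e = inv_into (carrier (free_group B)) (word_eval G (\<lambda>b. b))"
  have iso: "word_eval G (\<lambda>b. b) \<in> iso (free_group B) G" using B by (simp add: free_basis_def)
  have "e \<in> hom G (free_group B)"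
    unfolding e_def using group.iso_set_sym[OF group_free_group iso] by (simp add: iso_def)
  then have "word_eval G' \<phi> \<circ> e \<in> hom G G'"
    using group.word_eval_hom[OF G' \<phi>] by (rule Group.hom_compose)
  moreover have "(word_eval G' \<phi> \<circ> e) b = \<phi> b" if b: "b \<in> B" for b
  proof -
    have "b \<in> carrier G" "\<phi> b \<in> carrier G'" using b free_basisD(1)[OF B] \<phi> by auto
    moreover have "e (word_eval G (\<lambda>b. b) [(b, True)]) = [(b, True)]"
      unfolding e_def using iso b
      by (intro inv_into_f_f) (auto simp: iso_def bij_betw_def)
    ultimately show ?thesis using G' by (simp add: group.is_monoid)
  qed
  ultimately show ?thesis by blast
qed

lemma hom_eq_on_generate:
  assumes "group G" "group G'" "f \<in> hom G G'" "g \<in> hom G G'"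
    and "T \<subseteq> carrier G" "\<And>t. t \<in> T \<Longrightarrow> f t = g t" "x \<in> generate G T"
  shows "f x = g x"
proof -
  interpret f: group_hom G G' f using assms by (simp add: group_hom_def group_hom_axioms_def)
  interpret g: group_hom G G' g using assms by (simp add: group_hom_def group_hom_axioms_def)
  show ?thesis using assms(7)
  proof (induction rule: generate.induct)
    case (inv h)
    then show ?case using assms(5,6) by (metis f.hom_inv g.hom_inv subsetD)
  next
    case (eng h1 h2)
    then show ?case using f.G.generate_in_carrier[OF assms(5)] by simp
  qed (use assms in auto)
qed

section \<open>The Nielsen--Schreier theorem\<close>

text \<open>A Schreier transversal of the left cosets of \<open>H\<close>: the last clause says that every
  representative is joined to \<open>\<one>\<close>, letter by letter, by a path of representatives.\<close>

lemma (in group) schreier_transversal: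
  assumes H: "subgroup H G" and S: "S \<subseteq> carrier G" and gen: "generate G S = carrier G"
  obtains rep where
    "\<And>f. f \<in> carrier G \<Longrightarrow> rep f \<in> carrier G \<and> inv f \<otimes> rep f \<in> H"
    "\<And>f g. f \<in> carrier G \<Longrightarrow> g \<in> carrier G \<Longrightarrow> inv f \<otimes> g \<in> H \<Longrightarrow> rep f = rep g"
    "rep \<one> = \<one>"
    "\<forall>Q. Q \<one> \<longrightarrow>
       (\<forall>a g. (a \<in> S \<or> inv a \<in> S) \<and> a \<in> carrier G \<and> g \<in> carrier G \<and> Q (rep g) \<and>
          rep (a \<otimes> g) = a \<otimes> rep g \<longrightarrow> Q (a \<otimes> rep g)) \<longrightarrow>
       (\<forall>f\<in>carrier G. Q (rep f))"
proof -
  interpret H: subgroup H G by (rule H)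
  define A where "A = S \<union> m_inv G ` S"
  have A: "A \<subseteq> carrier G" using S by (auto simp: A_def)
  have A': "a \<in> S \<or> inv a \<in> S" if "a \<in> A" for a using that S by (auto simp: A_def)
  define ev where "ev = (\<lambda>w. foldr (\<otimes>) w \<one>)"
  have ev_Cons [simp]: "ev (a # w) = a \<otimes> ev w" for a w by (simp add: ev_def)
  have ev_cl: "ev w \<in> carrier G" if "set w \<subseteq> A" for w
    using that A by (induction w) (auto simp: ev_def)
  have ev_append: "ev (u @ v) = ev u \<otimes> ev v" if "set u \<subseteq> A" "set v \<subseteq> A" for u v
    using that A ev_cl by (induction u) (auto simp: m_assoc ev_def)
  have word: "\<exists>w. set w \<subseteq> A \<and> ev w = f" if "f \<in> carrier G" for f
    using that unfolding gen[symmetric]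
  proof (induction rule: generate.induct)
    case one
    show ?case by (rule exI[of _ "[]"]) (simp add: ev_def)
  next
    case (incl h)
    then show ?case using S by (intro exI[of _ "[h]"]) (auto simp: ev_def A_def)
  next
    case (inv h)
    then show ?case using S by (intro exI[of _ "[inv h]"]) (auto simp: ev_def A_def)
  next
    case (eng f g)
    then obtain u v where "set u \<subseteq> A" "ev u = f" "set v \<subseteq> A" "ev v = g" by blast
    then show ?case by (intro exI[of _ "u @ v"]) (auto simp: ev_append)
  qed
  \<comment> \<open>\<open>C f\<close> is the left coset of \<open>f\<close>, so left multiplication
    by a letter permutes the cosets.\<close>
  define C where "C f = {g \<in> carrier G. inv f \<otimes> g \<in> H}" for f
  have C_self: "f \<in> C f" if "f \<in> carrier G" for f using that by (simp add: C_def)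
  have C_eq: "C f = C g" if "f \<in> carrier G" "g \<in> carrier G" "inv f \<otimes> g \<in> H" for f g
  proof -
    have 1: "inv g \<otimes> k = inv (inv f \<otimes> g) \<otimes> (inv f \<otimes> k)" 
      and 2: "inv f \<otimes> k = (inv f \<otimes> g) \<otimes> (inv g \<otimes> k)" if "k \<in> carrier G" for k
      using that \<open>f \<in> carrier G\<close> \<open>g \<in> carrier G\<close> by (simp_all add: inv_mult_group m_assoc m_inv_cancel)
    have "inv f \<otimes> k \<in> H \<longleftrightarrow> inv g \<otimes> k \<in> H" if "k \<in> carrier G" for k
    proof
      assume "inv f \<otimes> k \<in> H"
      then show "inv g \<otimes> k \<in> H"
        unfolding 1[OF that] using H.m_inv_closed[OF \<open>inv f \<otimes> g \<in> H\<close>] by (rule H.m_closed[rotated])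
    next
      assume "inv g \<otimes> k \<in> H"
      then show "inv f \<otimes> k \<in> H"
        unfolding 2[OF that] by (rule H.m_closed[OF \<open>inv f \<otimes> g \<in> H\<close>])
    qed
    then show ?thesis by (auto simp: C_def)
  qed
  have C_mem: "C g = C f" if "f \<in> carrier G" "g \<in> C f" for f g
    using that by (intro C_eq[symmetric]) (simp_all add: C_def)
  have C_mult: "a \<otimes> g \<in> C (a \<otimes> f) \<longleftrightarrow> g \<in> C f"
    if "a \<in> carrier G" "f \<in> carrier G" "g \<in> carrier G" for a f g
    using that by (simp add: C_def inv_mult_group m_assoc m_inv_cancel)
  \<comment> \<open>The distance of a coset from \<open>H\<close> in the Schreier graph.\<close>
  define d where "d D = (LEAST n. \<exists>w. set w \<subseteq> A \<and> length w = n \<and> ev w \<in> D)" for D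
  have d_le: "d D \<le> length w" if "set w \<subseteq> A" "ev w \<in> D" for D w
    unfolding d_def using that by (intro Least_le) auto
  have d_ex: "\<exists>w. set w \<subseteq> A \<and> length w = d (C f) \<and> ev w \<in> C f" if "f \<in> carrier G" for f
    unfolding d_def by (rule LeastI_ex) (use word[OF that] C_self[OF that] in auto)
  define P where "P n D p \<longleftrightarrow> (case p of (a, g) \<Rightarrow> a \<in> A \<and> g \<in> carrier G \<and> d (C g) = n \<and> C (a \<otimes> g) = D)"
    for n D p
  \<comment> \<open>The tail of a shortest word for a coset leads to a coset exactly one step
    nearer: a shorter route to the tail's coset would, with the letter put back, shorten the word
    itself.\<close>
  have P_ex: "\<exists>p. P n (C f) p" if f: "f \<in> carrier G" and n: "d (C f) = Suc n" for f n
  proof -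
    obtain w where w: "set w \<subseteq> A" "length w = Suc n" "ev w \<in> C f" using d_ex[OF f] n by auto
    then obtain a v where v: "w = a # v" by (cases w) auto
    have cl: "a \<in> carrier G" "ev v \<in> carrier G" using w(1) v A ev_cl by auto
    have Cf: "C (a \<otimes> ev v) = C f" using C_mem[OF f, of "ev w"] w v by simp
    obtain u where u: "set u \<subseteq> A" "length u = d (C (ev v))" "ev u \<in> C (ev v)"
      using d_ex cl by blast
    have "d (C f) \<le> length (a # u)"
    proof (rule d_le)
      show "set (a # u) \<subseteq> A" using u w v by simp
      show "ev (a # u) \<in> C f"
        using C_mult[of a "ev v" "ev u"] cl u ev_cl[of u] Cf by simp
    qed
    moreover have "d (C (ev v)) \<le> length v" using w v cl by (intro d_le C_self) auto
    ultimately have "d (C (ev v)) = n" using n u w v by simp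
    then have "P n (C f) (a, ev v)" using Cf cl w v by (simp add: P_def)
    then show ?thesis ..
  qed
  \<comment> \<open>A coset at distance n + 1 receives a chosen letter times the representative of a
    chosen predecessor at distance n. The choice depends on the coset alone, so \<open>rep\<close>
    is constant on cosets, and the path clause holds by construction.\<close>
  define r where "r = rec_nat (\<lambda>D. \<one>) (\<lambda>n r D. let p = SOME p. P n D p in fst p \<otimes> r (C (snd p)))"
  have r_0: "r 0 D = \<one>" for D by (simp add: r_def)
  have r_Suc: "\<exists>a g. a \<in> A \<and> g \<in> carrier G \<and> d (C g) = n \<and> C (a \<otimes> g) = C f \<and> r (Suc n) (C f) = a \<otimes> r n (C g)"
    if "f \<in> carrier G" "d (C f) = Suc n" for f n
  proof -
    define p where "p = (SOME p. P n (C f) p)"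
    have "P n (C f) p" unfolding p_def by (rule someI_ex[OF P_ex[OF that]])
    moreover have "r (Suc n) (C f) = fst p \<otimes> r n (C (snd p))" by (simp add: r_def p_def Let_def)
    ultimately show ?thesis by (cases p) (auto simp: P_def)
  qed
  define rep where "rep f = r (d (C f)) (C f)" for f
  have rep_mem: "r n (C f) \<in> C f" if "f \<in> carrier G" "d (C f) = n" for f n
    using that
  proof (induction n arbitrary: f)
    case 0
    then show ?case using d_ex[of f] by (auto simp: r_0 ev_def)
  next
    case (Suc n)
    obtain a g where ag: "a \<in> A" "g \<in> carrier G" "d (C g) = n" "C (a \<otimes> g) = C f"
      "r (Suc n) (C f) = a \<otimes> r n (C g)" using r_Suc[OF Suc.prems] by blast
    have "r n (C g) \<in> C g" using Suc.IH ag by blast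
    then have "a \<otimes> r n (C g) \<in> C (a \<otimes> g)" using C_mult[of a g] ag A by (auto simp: C_def)
    then show ?case using ag by simp
  qed
  have d1: "d (C \<one>) = 0" using d_le[of "[]" "C \<one>"] C_self[of \<one>] by (simp add: ev_def)
  show ?thesis
  proof (rule that)
    show "rep f \<in> carrier G \<and> inv f \<otimes> rep f \<in> H" if "f \<in> carrier G" for f
      using rep_mem[OF that refl] by (simp add: rep_def C_def)
    show "rep f = rep g" if "f \<in> carrier G" "g \<in> carrier G" "inv f \<otimes> g \<in> H" for f g
      using C_eq[OF that] by (simp add: rep_def)
    show "rep \<one> = \<one>" by (simp add: rep_def d1 r_0)
    have "Q (rep f)"
      if one: "Q \<one>" and f: "f \<in> carrier G"
        and step: "\<And>a g. \<lbrakk>a \<in> S \<or> inv a \<in> S; a \<in> carrier G; g \<in> carrier G; Q (rep g);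
          rep (a \<otimes> g) = a \<otimes> rep g\<rbrakk> \<Longrightarrow> Q (a \<otimes> rep g)"
      for Q f
    proof -
      have "Q (rep f)" if "f \<in> carrier G" "d (C f) = n" for f n
        using that
      proof (induction n arbitrary: f)
        case 0
        then show ?case using one by (simp add: rep_def r_0)
      next
        case (Suc n)
        obtain a g where ag: "a \<in> A" "g \<in> carrier G" "d (C g) = n" "C (a \<otimes> g) = C f"
          "r (Suc n) (C f) = a \<otimes> r n (C g)" using r_Suc[OF Suc.prems] by blast
        then have "rep f = a \<otimes> rep g" "rep (a \<otimes> g) = a \<otimes> rep g" using Suc.prems by (simp_all add: rep_def)
        moreover have "Q (rep g)" using Suc.IH ag by blast
        ultimately show ?case using step[of a g] ag A A' by auto
      qed
      then show ?thesis using f by blast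
    qed
    then show "\<forall>Q. Q \<one> \<longrightarrow>
       (\<forall>a g. (a \<in> S \<or> inv a \<in> S) \<and> a \<in> carrier G \<and> g \<in> carrier G \<and> Q (rep g) \<and>
          rep (a \<otimes> g) = a \<otimes> rep g \<longrightarrow> Q (a \<otimes> rep g)) \<longrightarrow>
       (\<forall>f\<in>carrier G. Q (rep f))" by blast
  qed
qed

text \<open>Permutations may be prescribed freely on a basis: they form a map into the symmetric
  group \<open>BijGroup X\<close>, which extends to a homomorphism.\<close>

lemma (in group) free_basis_action:
  assumes B: "free_basis G B" and \<sigma>: "\<And>b. b \<in> B \<Longrightarrow> bij_betw (\<sigma> b) X X"
  obtains act where
    "\<And>f x. f \<in> carrier G \<Longrightarrow> x \<in> X \<Longrightarrow> act f x \<in> X"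
    "\<And>x. x \<in> X \<Longrightarrow> act \<one> x = x"
    "\<And>f g x. f \<in> carrier G \<Longrightarrow> g \<in> carrier G \<Longrightarrow> x \<in> X \<Longrightarrow> act (f \<otimes> g) x = act f (act g x)"
    "\<And>b x. b \<in> B \<Longrightarrow> x \<in> X \<Longrightarrow> act b x = \<sigma> b x"
proof -
  have "(\<lambda>b. restrict (\<sigma> b) X) \<in> B \<rightarrow> carrier (BijGroup X)"
  proof
    fix b assume "b \<in> B"
    then have "bij_betw (restrict (\<sigma> b) X) X X"
      using \<sigma> by (simp cong: bij_betw_cong)
    then show "restrict (\<sigma> b) X \<in> carrier (BijGroup X)" by (simp add: BijGroup_def Bij_def)
  qed
  then obtain act where act: "act \<in> hom G (BijGroup X)" "\<forall>b\<in>B. act b = restrict (\<sigma> b) X"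
    using free_basis_extend[OF B group_BijGroup] by blast
  interpret a: group_hom G "BijGroup X" act
    using act(1) is_group group_BijGroup[of X] by (simp add: group_hom_def group_hom_axioms_def)
  have Bij: "act f \<in> Bij X" if "f \<in> carrier G" for f
    using a.hom_closed[OF that] by (simp add: BijGroup_def)
  show ?thesis
  proof (rule that)
    show "act f x \<in> X" if "f \<in> carrier G" "x \<in> X" for f x
      using Bij_imp_funcset[OF Bij[OF that(1)]] that(2) by auto
    show "act \<one> x = x" if "x \<in> X" for x using a.hom_one that by (simp add: BijGroup_def)
    show "act (f \<otimes> g) x = act f (act g x)" if "f \<in> carrier G" "g \<in> carrier G" "x \<in> X" for f g x
      using a.hom_mult[OF that(1,2)] Bij that by (simp add: BijGroup_def compose_def)
    show "act b x = \<sigma> b x" if "b \<in> B" "x \<in> X" for b x using act(2) that by simp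
  qed
qed

text \<open>With \<open>T\<close> the Schreier transversal and \<open>Y\<close> the set of Schreier generators, the group acts
  on \<open>T \<times> free_group Y\<close> so that \<open>(t, u) \<mapsto> t \<gamma>(u)\<close> is equivariant; both generation and
  freeness are read off from the orbit of \<open>(\<one>, [])\<close>.\<close>

theorem (in group) nielsen_schreier:
  assumes B: "free_basis G B" and H: "subgroup H G"
  shows "\<exists>A. free_basis (G\<lparr>carrier := H\<rparr>) A"
proof -
  interpret H: subgroup H G by (rule H)
  note BD = free_basisD[OF B]
  obtain rep where rep: "\<And>f. f \<in> carrier G \<Longrightarrow> rep f \<in> carrier G \<and> inv f \<otimes> rep f \<in> H"
    and rep_eq: "\<And>f g. f \<in> carrier G \<Longrightarrow> g \<in> carrier G \<Longrightarrow> inv f \<otimes> g \<in> H \<Longrightarrow> rep f = rep g"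
    and rep_one: "rep \<one> = \<one>"
    and rep_ind:
    "\<forall>Q. Q \<one> \<longrightarrow>
       (\<forall>a g. (a \<in> B \<or> inv a \<in> B) \<and> a \<in> carrier G \<and> g \<in> carrier G \<and> Q (rep g) \<and>
          rep (a \<otimes> g) = a \<otimes> rep g \<longrightarrow> Q (a \<otimes> rep g)) \<longrightarrow>
       (\<forall>f\<in>carrier G. Q (rep f))"
    by (rule schreier_transversal[OF H BD(1,2)]) (rule that)
  have rep_cl [simp]: "rep f \<in> carrier G" if "f \<in> carrier G" for f using rep that by blast
  have Bcl [simp]: "s \<in> carrier G" if "s \<in> B" for s using BD(1) that by blast
  have rep_mult: "rep (a \<otimes> rep g) = rep (a \<otimes> g)" if "a \<in> carrier G" "g \<in> carrier G" for a g
  proof (rule rep_eq[symmetric])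
    have "inv (a \<otimes> g) \<otimes> (a \<otimes> rep g) = inv g \<otimes> rep g"
      using that by (simp add: inv_mult_group m_assoc m_inv_cancel)
    then show "inv (a \<otimes> g) \<otimes> (a \<otimes> rep g) \<in> H" using rep[OF that(2)] by simp
  qed (use that in simp_all)
  have rep_rep: "rep (rep g) = rep g" if "g \<in> carrier G" for g
    using rep_mult[of \<one> g] that by simp
  define T where "T = rep ` carrier G"
  have T_cl [simp]: "t \<in> carrier G" if "t \<in> T" for t using that by (auto simp: T_def)
  have T_rep: "rep t = t" if "t \<in> T" for t using that rep_rep by (auto simp: T_def)
  have rep_T [simp]: "rep f \<in> T" if "f \<in> carrier G" for f using that by (simp add: T_def)
  \<comment> \<open>The Schreier generators, given by \<open>s \<otimes> t = rep (s \<otimes> t)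
    \<otimes> \<gamma> (s, t)\<close>. The set \<open>Y\<close> below consists of labels, not of
    values, so that distinctness of the values becomes part of freeness.\<close>
  define \<gamma> where "\<gamma> = (\<lambda>(s, t). inv (rep (s \<otimes> t)) \<otimes> (s \<otimes> t))"
  have \<gamma>_H: "\<gamma> (s, t) \<in> H" if "s \<in> B" "t \<in> T" for s t
  proof -
    have "inv (inv (s \<otimes> t) \<otimes> rep (s \<otimes> t)) \<in> H" using rep[of "s \<otimes> t"] that by (intro H.m_inv_closed) simp
    then show ?thesis using that by (simp add: \<gamma>_def inv_mult_group m_assoc)
  qed
  define Y where "Y = {p \<in> B \<times> T. \<gamma> p \<noteq> \<one>}"
  have \<gamma>_Y: "\<gamma> \<in> Y \<rightarrow> H" using \<gamma>_H by (auto simp: Y_def)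
  then have \<gamma>_Y': "\<gamma> \<in> Y \<rightarrow> carrier G" using H.subset by auto
  define U where "U = carrier (free_group Y)"
  have red: "red_cons (p, c) u \<in> U" if "p \<in> Y" "u \<in> U" for p c u
    using that subset_trans[OF red_cons_set[of "(p, c)" u], of Y]
    by (simp add: U_def carrier_free_group red_cons_red)
  have cancel: "red_cons (p, c) (red_cons (p, \<not> c) u) = u" if "u \<in> U" for p c u
    using that by (intro red_cons_cancel) (auto simp: U_def carrier_free_group cancelling_def)
  define \<tau> where "\<tau> c p u = (if p \<in> Y then red_cons (p, c) u else u)" for c p u
  have \<tau>_U: "\<tau> c p u \<in> U" if "u \<in> U" for c p u using that red by (simp add: \<tau>_def)
  have \<tau>_cancel: "\<tau> c p (\<tau> (\<not> c) p u) = u" if "u \<in> U" for c p u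
    using that cancel by (simp add: \<tau>_def)
  \<comment> \<open>This imitates left multiplication by \<open>s\<close> on products t u with u in
    \<open>H\<close>, where s t u = rep(s t) \<gamma>(s, t) u. Keeping u as a word presupposes no
    freeness of the generators.\<close>
  define \<sigma> where "\<sigma> s = (\<lambda>(t, u). (rep (s \<otimes> t), \<tau> True (s, t) u))" for s
  have \<sigma>_bij: "bij_betw (\<sigma> s) (T \<times> U) (T \<times> U)" if s: "s \<in> B" for s
  proof -
    define \<sigma>' where "\<sigma>' = (\<lambda>(t, u). (rep (inv s \<otimes> t), \<tau> False (s, rep (inv s \<otimes> t)) u))"
    have 1: "rep (s \<otimes> rep (inv s \<otimes> t)) = t" "rep (inv s \<otimes> rep (s \<otimes> t)) = t" if "t \<in> T" for t
      using that s by (simp_all add: rep_mult T_rep m_assoc[symmetric])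
    show ?thesis
    proof (rule bij_betw_byWitness[where f' = \<sigma>'])
      show "\<forall>a\<in>T \<times> U. \<sigma>' (\<sigma> s a) = a"
        using 1 \<tau>_cancel[of _ False] by (auto simp: \<sigma>_def \<sigma>'_def)
      show "\<forall>a\<in>T \<times> U. \<sigma> s (\<sigma>' a) = a"
        using 1 \<tau>_cancel[of _ True] by (auto simp: \<sigma>_def \<sigma>'_def)
      show "\<sigma> s ` (T \<times> U) \<subseteq> T \<times> U" using s \<tau>_U by (auto simp: \<sigma>_def)
      show "\<sigma>' ` (T \<times> U) \<subseteq> T \<times> U" using s \<tau>_U by (auto simp: \<sigma>'_def)
    qed
  qed
  obtain act where act_cl: "\<And>f x. f \<in> carrier G \<Longrightarrow> x \<in> T \<times> U \<Longrightarrow> act f x \<in> T \<times> U"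
    and act_one: "\<And>x. x \<in> T \<times> U \<Longrightarrow> act \<one> x = x"
    and act_mult: "\<And>f g x. f \<in> carrier G \<Longrightarrow> g \<in> carrier G \<Longrightarrow> x \<in> T \<times> U \<Longrightarrow>
      act (f \<otimes> g) x = act f (act g x)"
    and act_B: "\<And>b x. b \<in> B \<Longrightarrow> x \<in> T \<times> U \<Longrightarrow> act b x = \<sigma> b x"
    by (rule free_basis_action[where \<sigma> = \<sigma>, OF B \<sigma>_bij]) (assumption, rule that)
  have act_inv: "act (inv f) (act f x) = x" if "f \<in> carrier G" "x \<in> T \<times> U" for f x
    using act_mult[of "inv f" f x] act_one that by simp
  have Nil_U: "[] \<in> U" by (simp add: U_def carrier_free_group)
  have one_T: "\<one> \<in> T" using rep_T[of \<one>] rep_one by simp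

  define ev where "ev = (\<lambda>(t, u). t \<otimes> word_eval G \<gamma> u)"
  have we_H: "word_eval G \<gamma> u \<in> H" if "u \<in> U" for u
    using that \<gamma>_Y by (intro word_eval_in_subgroup[OF H]) (auto simp: U_def carrier_free_group)
  have ev_\<sigma>: "ev (\<sigma> s x) = s \<otimes> ev x" if s: "s \<in> B" and x: "x \<in> T \<times> U" for s x
  proof -
    obtain t u where tu: "x = (t, u)" "t \<in> T" "u \<in> U" using x by blast
    have u: "word_eval G \<gamma> u \<in> carrier G" using we_H[OF tu(3)] H.subset by blast
    have g: "\<gamma> (s, t) \<in> carrier G" using \<gamma>_H[OF s tu(2)] H.subset by blast
    have "word_eval G \<gamma> (\<tau> True (s, t) u) = \<gamma> (s, t) \<otimes> word_eval G \<gamma> u"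
    proof (cases "(s, t) \<in> Y")
      case True
      then have "word_eval G \<gamma> (red_cons ((s, t), True) u) = word_eval G \<gamma> (((s, t), True) # u)"
        using \<gamma>_Y' tu by (intro word_eval_red_cons) (auto simp: U_def carrier_free_group)
      then show ?thesis using True by (simp add: \<tau>_def)
    next
      case False
      then have "\<gamma> (s, t) = \<one>" using s tu by (simp add: Y_def)
      then show ?thesis using False u by (simp add: \<tau>_def)
    qed
    moreover have "rep (s \<otimes> t) \<otimes> \<gamma> (s, t) = s \<otimes> t"
      using s tu by (simp add: \<gamma>_def m_assoc[symmetric])
    ultimately show ?thesis using s tu u g by (simp add: ev_def \<sigma>_def m_assoc[symmetric])
  qed
  have ev_cl: "ev x \<in> carrier G" if "x \<in> T \<times> U" for x
    using that we_H H.subset by (auto simp: ev_def)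
  have ev_act: "ev (act f x) = f \<otimes> ev x" if "f \<in> generate G B" "x \<in> T \<times> U" for f x
    using that
  proof (induction arbitrary: x rule: generate.induct)
    case one
    then show ?case using act_one ev_cl by simp
  next
    case (incl h)
    then show ?case using act_B ev_\<sigma> by simp
  next
    case (inv h)
    have y: "act (inv h) x \<in> T \<times> U" using inv act_cl by simp
    have "act h (act (inv h) x) = x" using act_inv[of "inv h" x] inv by simp
    then have "ev x = h \<otimes> ev (act (inv h) x)" using act_B[OF _ y] ev_\<sigma>[OF _ y] inv by metis
    then show ?case using inv ev_cl[OF y] by (simp add: m_assoc[symmetric])
  next
    case (eng f g)
    then have "f \<in> carrier G" "g \<in> carrier G" using generate_in_carrier[OF BD(1)] by auto
    with eng show ?case using act_mult act_cl ev_cl by (simp add: m_assoc)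
  qed

  \<comment> \<open>For h in \<open>H\<close> the orbit point (t, u) of the base point satisfies t
    \<gamma>(u) = h. So t lies in \<open>H\<close>, hence is the representative
    \<open>\<one>\<close>, and u spells h.\<close>
  have gen: "word_eval G \<gamma> ` U = H"
  proof
    show "word_eval G \<gamma> ` U \<subseteq> H" using we_H by blast
    show "H \<subseteq> word_eval G \<gamma> ` U"
    proof
      fix h assume h: "h \<in> H"
      then have hc: "h \<in> carrier G" by (rule H.mem_carrier)
      obtain t u where tu: "act h (\<one>, []) = (t, u)" "t \<in> T" "u \<in> U"
        using act_cl[OF hc, of "(\<one>, [])"] one_T Nil_U by auto
      have "ev (t, u) = h" using ev_act[of h "(\<one>, [])"] hc BD(2) one_T Nil_U tu by (simp add: ev_def)
      then have e: "t \<otimes> word_eval G \<gamma> u = h" by (simp add: ev_def)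
      have "t = h \<otimes> inv (word_eval G \<gamma> u)"
        using e tu we_H[OF tu(3)] by (auto simp: m_assoc)
      then have "t \<in> H" using h we_H[OF tu(3)] by simp
      then have "rep t = rep \<one>" by (intro rep_eq) (auto intro: H.m_inv_closed)
      then have "t = \<one>" using T_rep[OF tu(2)] rep_one by simp
      then show "h \<in> word_eval G \<gamma> ` U" using e tu we_H[OF tu(3)] by auto
    qed
  qed

  \<comment> \<open>The Schreier property is essential here: every letter on the path of
    representatives to t has a trivial generator, so the word component stays untouched.\<close>
  have act_T: "act t (\<one>, u) = (t, u)" if t: "t \<in> T" and u: "u \<in> U" for t u
  proof -
    have "\<forall>f\<in>carrier G. \<forall>u\<in>U. act (rep f) (\<one>, u) = (rep f, u)"
    proof (rule rep_ind[THEN spec[of _ "\<lambda>t. \<forall>u\<in>U. act t (\<one>, u) = (t, u)"], THEN mp, THEN mp];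
        (intro allI impI; (elim conjE)?)?)
      show "\<forall>u\<in>U. act \<one> (\<one>, u) = (\<one>, u)" using act_one one_T by simp
      fix a g
      assume a: "a \<in> B \<or> inv a \<in> B" "a \<in> carrier G" and g: "g \<in> carrier G"
        and IH: "\<forall>u\<in>U. act (rep g) (\<one>, u) = (rep g, u)" and ag: "rep (a \<otimes> g) = a \<otimes> rep g"
      have agT: "a \<otimes> rep g \<in> T" using rep_T[of "a \<otimes> g"] a g ag by simp
      show "\<forall>u\<in>U. act (a \<otimes> rep g) (\<one>, u) = (a \<otimes> rep g, u)"
      proof
        fix u assume u: "u \<in> U"
        have 1: "act (a \<otimes> rep g) (\<one>, u) = act a (rep g, u)"
          using act_mult a g u one_T IH by simp
        show "act (a \<otimes> rep g) (\<one>, u) = (a \<otimes> rep g, u)"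
        proof (cases "a \<in> B")
          case True
          have "\<gamma> (a, rep g) = \<one>" using a g ag by (simp add: \<gamma>_def rep_mult)
          then have "\<sigma> a (rep g, u) = (a \<otimes> rep g, u)"
            using a g ag by (simp add: \<sigma>_def \<tau>_def Y_def rep_mult)
          then show ?thesis using 1 act_B[OF True] g u by simp
        next
          case False
          then have s: "inv a \<in> B" using a by simp
          have e: "inv a \<otimes> (a \<otimes> rep g) = rep g" using a g by (simp add: m_assoc[symmetric])
          have "\<gamma> (inv a, a \<otimes> rep g) = \<one>" using a g e by (simp add: \<gamma>_def rep_rep)
          then have "\<sigma> (inv a) (a \<otimes> rep g, u) = (rep g, u)"
            using e g by (simp add: \<sigma>_def \<tau>_def Y_def rep_rep)
          then have "act (inv a) (a \<otimes> rep g, u) = (rep g, u)" using act_B[OF s] agT u by simp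
          then have "act a (rep g, u) = (a \<otimes> rep g, u)"
            using act_inv[of "inv a" "(a \<otimes> rep g, u)"] a agT u by simp
          then show ?thesis using 1 by simp
        qed
      qed
    qed
    from bspec[OF bspec[OF this T_cl[OF t]] u] show ?thesis by (simp add: T_rep[OF t])
  qed
  \<comment> \<open>In \<open>inv (rep (s \<otimes> t)) \<otimes> (s \<otimes> t)\<close> the two
    representatives move only the first component, and \<open>s\<close> adds the letter
    \<open>p\<close>. Over \<open>\<one>\<close> the generators therefore act as in the free group
    on \<open>Y\<close>.\<close>
  have act_\<gamma>: "act (\<gamma> p) (\<one>, u) = (\<one>, red_cons (p, True) u)" if p: "p \<in> Y" and u: "u \<in> U" for p u
  proof -
    obtain s t where st: "p = (s, t)" "s \<in> B" "t \<in> T" using p by (auto simp: Y_def)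
    let ?v = "red_cons (p, True) u"
    have v: "?v \<in> U" using red p u by blast
    have "act (\<gamma> p) (\<one>, u) = act (inv (rep (s \<otimes> t))) (act (s \<otimes> t) (\<one>, u))"
      using st u one_T by (simp add: \<gamma>_def act_mult)
    also have "act (s \<otimes> t) (\<one>, u) = \<sigma> s (t, u)" using st u one_T by (simp add: act_mult act_T act_B)
    also have "\<dots> = (rep (s \<otimes> t), ?v)" using p st by (simp add: \<sigma>_def \<tau>_def)
    also have "\<dots> = act (rep (s \<otimes> t)) (\<one>, ?v)" using act_T v st by simp
    also have "act (inv (rep (s \<otimes> t))) \<dots> = (\<one>, ?v)" using act_inv st v one_T by simp
    finally show ?thesis .
  qed
  have act_word: "act (word_eval G \<gamma> w) (\<one>, []) = (\<one>, foldr red_cons w []) \<and> foldr red_cons w [] \<in> U"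
    if "fst ` set w \<subseteq> Y" for w
    using that
  proof (induction w)
    case Nil
    then show ?case using act_one one_T Nil_U by simp
  next
    case (Cons a w)
    obtain p c where a: "a = (p, c)" by (cases a)
    let ?u = "foldr red_cons w []"
    have p: "p \<in> Y" and pc: "\<gamma> p \<in> carrier G" using Cons.prems a \<gamma>_Y' by auto
    have IH: "act (word_eval G \<gamma> w) (\<one>, []) = (\<one>, ?u)" and u: "?u \<in> U" using Cons by auto
    have wc: "word_eval G \<gamma> w \<in> carrier G" using Cons.prems \<gamma>_Y' by (intro word_eval_closed) auto
    have "act (inv (\<gamma> p)) (\<one>, ?u) = (\<one>, red_cons (p, False) ?u)"
      using act_\<gamma>[OF p red[OF p u, of False]] cancel[OF u, of p True]
        act_inv[OF pc, of "(\<one>, red_cons (p, False) ?u)"] one_T red[OF p u] by simp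
    then have "act (word_eval G \<gamma> (a # w)) (\<one>, []) = (\<one>, red_cons a ?u)"
      using a act_\<gamma>[OF p u] IH pc wc one_T Nil_U by (simp add: act_mult)
    then show ?case using red[OF p u] a by simp
  qed
  \<comment> \<open>A relation fixes the base point, yet by \<open>act_word\<close> it also carries
    the empty word to the relation itself.\<close>
  have triv: "w = []" if w: "w \<in> carrier (free_group Y)" "word_eval G \<gamma> w = \<one>" for w
  proof -
    have "foldr red_cons w [] = []"
      using act_word[of w] w act_one one_T Nil_U by (simp add: carrier_free_group)
    then show ?thesis using w foldr_red_cons_Nil[of w] by (simp add: carrier_free_group)
  qed

  interpret GH: group "G\<lparr>carrier := H\<rparr>" using subgroup_imp_group[OF H] .
  have sub: "\<gamma> ` fst ` set w \<subseteq> H" if "w \<in> carrier (free_group Y)" for w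
    using that \<gamma>_Y by (auto simp: carrier_free_group)
  have "generate (G\<lparr>carrier := H\<rparr>) (\<gamma> ` Y) = H"
    using GH.word_eval_image[of \<gamma> Y] \<gamma>_Y gen word_eval_subgroup[OF H sub]
    by (simp add: U_def)
  then have "free_basis (G\<lparr>carrier := H\<rparr>) (\<gamma> ` Y)"
    using \<gamma>_Y triv word_eval_subgroup[OF H sub] by (intro GH.free_basisI) auto
  then show ?thesis ..
qed

section \<open>Counting homomorphisms to finite groups\<close>

text \<open>Send the basis elements outside \<open>B'\<close> to the identity, extend to a
  homomorphism and restrict it to \<open>T\<close>. Homomorphisms that agree on \<open>T\<close>
  agree on \<open>B'\<close>, so nothing is lost. Both counting arguments below are
  instances.\<close>

lemma (in group) restrict_homs_inj:
  assumes B: "free_basis G B" and B': "B' \<subseteq> B" and G': "group G'"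
    and T: "T \<subseteq> carrier G" "B' \<subseteq> generate G T"
  shows "\<exists>\<Phi>. inj_on \<Phi> (B' \<rightarrow>\<^sub>E carrier G') \<and> \<Phi> \<in> (B' \<rightarrow>\<^sub>E carrier G') \<rightarrow> (T \<rightarrow>\<^sub>E carrier G') \<and>
    (\<forall>\<phi>\<in>B' \<rightarrow>\<^sub>E carrier G'. \<exists>f\<in>hom G G'. \<forall>t\<in>T. f t = \<Phi> \<phi> t)"
proof -
  interpret G': group G' by (rule G')
  define P where "P \<phi> f \<longleftrightarrow> f \<in> hom G G' \<and> (\<forall>b\<in>B'. f b = \<phi> b)" for \<phi> f
  define ext where "ext \<phi> = (SOME f. P \<phi> f)" for \<phi>
  have ext: "P \<phi> (ext \<phi>)" if "\<phi> \<in> B' \<rightarrow>\<^sub>E carrier G'" for \<phi>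
  proof -
    have "(\<lambda>b. if b \<in> B' then \<phi> b else \<one>\<^bsub>G'\<^esub>) \<in> B \<rightarrow> carrier G'" using that by auto
    then obtain f where "f \<in> hom G G'" "\<forall>b\<in>B. f b = (if b \<in> B' then \<phi> b else \<one>\<^bsub>G'\<^esub>)"
      using free_basis_extend[OF B G'] by blast
    then have "P \<phi> f" using B' by (auto simp: P_def)
    then show ?thesis unfolding ext_def by (rule someI[of "P \<phi>"])
  qed
  define \<Phi> where "\<Phi> \<phi> = restrict (ext \<phi>) T" for \<phi>
  show ?thesis
  proof (intro exI[of _ \<Phi>] conjI ballI)
    show "\<Phi> \<in> (B' \<rightarrow>\<^sub>E carrier G') \<rightarrow> (T \<rightarrow>\<^sub>E carrier G')"
    proof
      fix \<phi> assume "\<phi> \<in> B' \<rightarrow>\<^sub>E carrier G'"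
      then have "ext \<phi> \<in> hom G G'" using ext by (simp add: P_def)
      then show "\<Phi> \<phi> \<in> T \<rightarrow>\<^sub>E carrier G'" using T(1) by (auto simp: \<Phi>_def hom_def)
    qed
    show "\<exists>f\<in>hom G G'. \<forall>t\<in>T. f t = \<Phi> \<phi> t" if "\<phi> \<in> B' \<rightarrow>\<^sub>E carrier G'" for \<phi>
      using ext[OF that] by (auto simp: \<Phi>_def P_def)
    show "inj_on \<Phi> (B' \<rightarrow>\<^sub>E carrier G')"
    proof (rule inj_onI)
      fix \<phi> \<psi> assume \<phi>: "\<phi> \<in> B' \<rightarrow>\<^sub>E carrier G'" and \<psi>: "\<psi> \<in> B' \<rightarrow>\<^sub>E carrier G'" and eq: "\<Phi> \<phi> = \<Phi> \<psi>"
      have T_eq: "ext \<phi> t = ext \<psi> t" if "t \<in> T" for t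
        using fun_cong[OF eq, of t] that by (simp add: \<Phi>_def)
      have "ext \<phi> \<in> hom G G'" "ext \<psi> \<in> hom G G'" using ext[OF \<phi>] ext[OF \<psi>] by (simp_all add: P_def)
      then have "ext \<phi> b = ext \<psi> b" if "b \<in> B'" for b
        using hom_eq_on_generate[where f = "ext \<phi>" and g = "ext \<psi>", OF is_group G' _ _ T(1) T_eq, of b]
          T(2) that by blast
      then show "\<phi> = \<psi>"
        using ext[OF \<phi>] ext[OF \<psi>] by (intro PiE_ext[OF \<phi> \<psi>]) (simp add: P_def)
    qed
  qed
qed

text \<open>With a group of order two as target, counting gives
  \<open>2 ^ card B' \<le> 2 ^ card T\<close>. A finite part \<open>B'\<close> of the basis is
  considered because this bound is what later shows that the whole basis is finite.\<close>

lemma (in group) card_free_basis_le: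
  assumes B: "free_basis G B" "B' \<subseteq> B" "finite B'"
    and T: "finite T" "T \<subseteq> carrier G" "B' \<subseteq> generate G T"
  shows "card B' \<le> card T"
proof -
  let ?Z = "integer_mod_group 2"
  have fin: "finite (carrier ?Z)" and two: "card (carrier ?Z) = 2"
    by (simp_all add: carrier_integer_mod_group)
  obtain \<Phi> where "inj_on \<Phi> (B' \<rightarrow>\<^sub>E carrier ?Z)" "\<Phi> \<in> (B' \<rightarrow>\<^sub>E carrier ?Z) \<rightarrow> (T \<rightarrow>\<^sub>E carrier ?Z)"
    using restrict_homs_inj[OF B(1,2) group_integer_mod_group T(2,3)] by blast
  then have "card (B' \<rightarrow>\<^sub>E carrier ?Z) \<le> card (T \<rightarrow>\<^sub>E carrier ?Z)"
    using T(1) fin by (intro card_inj_on_le[of \<Phi>] finite_PiE) auto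
  then show ?thesis using B(3) T(1) two by (simp add: card_funcsetE)
qed

text \<open>Restriction to \<open>T\<close> is an injection between finite sets of equal size, hence
  onto: every assignment on \<open>T\<close> is realised by a homomorphism.\<close>

lemma (in group) generators_extend:
  assumes B: "free_basis G B" "finite B"
    and T: "finite T" "T \<subseteq> carrier G" "generate G T = carrier G" "card T = card B"
    and G': "group G'" "finite (carrier G')" and \<tau>: "\<tau> \<in> T \<rightarrow> carrier G'"
  obtains f where "f \<in> hom G G'" "\<And>t. t \<in> T \<Longrightarrow> f t = \<tau> t"
proof -
  have "B \<subseteq> generate G T" using free_basisD(1)[OF B(1)] T(3) by simp
  then obtain \<Phi> where inj: "inj_on \<Phi> (B \<rightarrow>\<^sub>E carrier G')" and \<Phi>: "\<Phi> \<in> (B \<rightarrow>\<^sub>E carrier G') \<rightarrow> (T \<rightarrow>\<^sub>E carrier G')"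
    and ext: "\<forall>\<phi>\<in>B \<rightarrow>\<^sub>E carrier G'. \<exists>f\<in>hom G G'. \<forall>t\<in>T. f t = \<Phi> \<phi> t"
    using restrict_homs_inj[OF B(1) subset_refl G'(1) T(2)] by blast
  have "\<Phi> ` (B \<rightarrow>\<^sub>E carrier G') = T \<rightarrow>\<^sub>E carrier G'"
  proof (rule card_subset_eq)
    show "finite (T \<rightarrow>\<^sub>E carrier G')" using T(1) G'(2) by (simp add: finite_PiE)
    show "\<Phi> ` (B \<rightarrow>\<^sub>E carrier G') \<subseteq> T \<rightarrow>\<^sub>E carrier G'" using \<Phi> by blast
    show "card (\<Phi> ` (B \<rightarrow>\<^sub>E carrier G')) = card (T \<rightarrow>\<^sub>E carrier G')"
      using T(1,4) B(2) by (simp add: card_image[OF inj] card_funcsetE)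
  qed
  moreover have "restrict \<tau> T \<in> T \<rightarrow>\<^sub>E carrier G'" using \<tau> by simp
  ultimately have "restrict \<tau> T \<in> \<Phi> ` (B \<rightarrow>\<^sub>E carrier G')" by (simp only:)
  then obtain \<phi> where "\<phi> \<in> B \<rightarrow>\<^sub>E carrier G'" "\<Phi> \<phi> = restrict \<tau> T" by (metis imageE)
  then obtain f where "f \<in> hom G G'" "\<forall>t\<in>T. f t = restrict \<tau> T t" using ext by metis
  then show ?thesis using that by simp
qed

section \<open>Free groups are residually finite and torsion-free\<close>

text \<open>Domain and image have complements of equal size, which can be matched
  arbitrarily.\<close>

lemma inj_on_extend_bij:
  assumes "finite A" "D \<subseteq> A" "inj_on f D" "f ` D \<subseteq> A"
  obtains g where "bij_betw g A A" "\<And>x. x \<in> D \<Longrightarrow> g x = f x"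
proof -
  have fin: "finite D" using assms finite_subset by blast
  have "card (A - D) = card (A - f ` D)"
    using assms fin by (simp add: card_Diff_subset card_image)
  then obtain h where h: "bij_betw h (A - D) (A - f ` D)"
    using finite_same_card_bij[of "A - D" "A - f ` D"] assms(1) by auto
  define g where "g x = (if x \<in> D then f x else h x)" for x
  have "bij_betw g D (f ` D)" using assms(3) by (simp add: g_def bij_betw_def inj_on_def)
  moreover have "bij_betw g (A - D) (A - f ` D)"
    using h by (rule bij_betw_cong[THEN iffD1, rotated]) (simp add: g_def)
  ultimately have "bij_betw g (D \<union> (A - D)) (f ` D \<union> (A - f ` D))"
    by (rule bij_betw_combine) auto
  then have "bij_betw g A A" using assms(2,4) by (simp add: Un_absorb1)
  then show ?thesis using that by (simp add: g_def)
qed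

text \<open>The \<open>i\<close>-th letter of \<open>w\<close> is made to move the point \<open>i + 1\<close> to \<open>i\<close>. As \<open>w\<close> is reduced this
  prescribes a partial injection of \<open>{0..length w}\<close> for every generator.\<close>

lemma free_group_residually_finite:
  fixes S :: "'x set"
  assumes w: "w \<in> carrier (free_group S)" "w \<noteq> []"
  obtains G' :: "(nat \<Rightarrow> nat) monoid" and \<phi>
    where "group G'" "finite (carrier G')" "\<And>x :: 'x. \<phi> x \<in> carrier G'" "word_eval G' \<phi> w \<noteq> \<one>\<^bsub>G'\<^esub>"
proof -
  define m where "m = length w"
  let ?A = "{0..m}"
  have red: "\<not> cancelling (w ! i) (w ! Suc i)" if "Suc i < m" for i
    using w(1) that by (simp add: carrier_free_group successively_conv_nth m_def)
  \<comment> \<open>\<open>R x i j\<close> is the demand that the permutation for \<open>x\<close>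
    move i to j; an inverse letter is read as the opposite demand on \<open>x\<close>. Two demands
    could clash only where adjacent letters of \<open>w\<close> cancel.\<close>
  define R where "R x i j \<longleftrightarrow> (i < m \<and> w ! i = (x, False) \<and> j = Suc i) \<or>
      (j < m \<and> w ! j = (x, True) \<and> i = Suc j)" for x i j
  have R_fun: "j = k" if "R x i j" "R x i k" for x i j k
    using that red[of j] red[of k] by (auto simp: R_def cancelling_def)
  have R_inj: "i = k" if "R x i j" "R x k j" for x i j k
    using that red[of i] red[of k] by (auto simp: R_def cancelling_def)
  have R_dom: "i \<in> ?A" "j \<in> ?A" if "R x i j" for x i j using that by (auto simp: R_def)
  have "\<exists>g. bij_betw g ?A ?A \<and> (\<forall>i j. R x i j \<longrightarrow> g i = j)" for x
  proof -
    define f where "f i = (THE j. R x i j)" for i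
    have f: "f i = j" if "R x i j" for i j
      unfolding f_def using that R_fun by (intro the_equality) blast+
    obtain g where "bij_betw g ?A ?A" "\<And>i. i \<in> {i. \<exists>j. R x i j} \<Longrightarrow> g i = f i"
    proof (rule inj_on_extend_bij[of ?A "{i. \<exists>j. R x i j}" f])
      show "inj_on f {i. \<exists>j. R x i j}" using f R_inj by (auto simp: inj_on_def)
      show "f ` {i. \<exists>j. R x i j} \<subseteq> ?A" using f R_dom(2) by blast
      show "{i. \<exists>j. R x i j} \<subseteq> ?A" using R_dom(1) by blast
    qed auto
    then show ?thesis using f by blast
  qed
  then obtain \<sigma> where \<sigma>: "\<And>x. bij_betw (\<sigma> x) ?A ?A" "\<And>x i j. R x i j \<Longrightarrow> \<sigma> x i = j" by metis
  define G' where "G' = BijGroup ?A"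
  define \<phi> where "\<phi> x = restrict (\<sigma> x) ?A" for x
  have grp: "group G'" by (simp add: G'_def group_BijGroup)
  interpret G': group G' by (rule grp)
  have "carrier G' \<subseteq> ?A \<rightarrow>\<^sub>E ?A"
    by (auto simp: G'_def BijGroup_def Bij_def PiE_def bij_betw_def)
  then have fin: "finite (carrier G')" by (rule finite_subset) (simp add: finite_PiE)
  have \<phi>: "\<phi> x \<in> carrier G'" for x
    using \<sigma>(1)[of x] bij_betw_cong[of ?A "restrict (\<sigma> x) ?A" "\<sigma> x" ?A]
    by (simp add: G'_def BijGroup_def Bij_def \<phi>_def)
  have mult: "(g \<otimes>\<^bsub>G'\<^esub> h) i = g (h i)" if "g \<in> carrier G'" "h \<in> carrier G'" "i \<in> ?A" for g h i
    using that by (simp add: G'_def BijGroup_def compose_def)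
  have one: "\<one>\<^bsub>G'\<^esub> i = i" if "i \<in> ?A" for i using that by (simp add: G'_def BijGroup_def)
  have letter: "(if b then \<phi> x else inv\<^bsub>G'\<^esub> \<phi> x) (Suc i) = i" if "i < m" "w ! i = (x, b)" for i x b
  proof (cases b)
    case True
    then show ?thesis using that \<sigma>(2)[of x "Suc i" i] by (simp add: R_def \<phi>_def)
  next
    case False
    then have "\<phi> x i = Suc i" using that \<sigma>(2)[of x i "Suc i"] by (simp add: R_def \<phi>_def)
    moreover have "(inv\<^bsub>G'\<^esub> \<phi> x) (\<phi> x i) = i"
      using mult[of "inv\<^bsub>G'\<^esub> \<phi> x" "\<phi> x" i] one[of i] \<phi> that by simp
    ultimately show ?thesis using False by simp
  qed
  \<comment> \<open>The last letter acts first, so the suffix starting at i carries the point m to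
    i. The whole word then carries m to 0, and m is positive.\<close>
  have "word_eval G' \<phi> (drop i w) m = i" if "i \<le> m" for i
    using that
  proof (induction rule: inc_induct)
    case base
    then show ?case using one[of m] by (simp add: m_def)
  next
    case (step i)
    obtain x b where xb: "w ! i = (x, b)" by (cases "w ! i")
    have "drop i w = (x, b) # drop (Suc i) w"
      using step xb by (metis Cons_nth_drop_Suc m_def)
    moreover have "word_eval G' \<phi> (drop (Suc i) w) \<in> carrier G'"
      using \<phi> by (intro G'.word_eval_closed) auto
    ultimately have "word_eval G' \<phi> (drop i w) m =
        (if b then \<phi> x else inv\<^bsub>G'\<^esub> \<phi> x) (word_eval G' \<phi> (drop (Suc i) w) m)"
      using mult \<phi> by simp
    then show ?case using step letter xb by simp
  qed
  from this[of 0] have "word_eval G' \<phi> w \<noteq> \<one>\<^bsub>G'\<^esub>" using one[of m] w(2) by (auto simp: m_def)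
  then show ?thesis using that grp fin \<phi> by blast
qed

text \<open>The subgroup generated by x is free with a non-empty basis, hence maps to the integers
  with every basis element going to 1. If x had finite order its image would be 0, and the map would
  vanish since x generates.\<close>

lemma (in group) free_group_torsion_free:
  assumes B: "free_basis G B" and x: "x \<in> carrier G" "x \<noteq> \<one>" and n: "n > 0"
  shows "x [^] (n :: nat) \<noteq> \<one>"
proof
  assume pow: "x [^] n = \<one>"
  define C where "C = generate G {x}"
  have C: "subgroup C G" unfolding C_def using x by (intro generate_is_subgroup) auto
  interpret C: group "G\<lparr>carrier := C\<rparr>" using subgroup_imp_group[OF C] .
  obtain A where A: "free_basis (G\<lparr>carrier := C\<rparr>) A" using nielsen_schreier[OF B C] by blast
  have xC: "x \<in> C" unfolding C_def by (rule generate.incl) simp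
  have genC: "generate (G\<lparr>carrier := C\<rparr>) {x} = C"
    using generate_consistent[of "{x}" C] xC C by (simp add: C_def)
  have "A \<noteq> {}"
    using C.free_basisD(2)[OF A] C.generate_empty xC x(2) by auto
  then obtain a where a: "a \<in> A" by blast
  obtain f where f: "f \<in> hom (G\<lparr>carrier := C\<rparr>) integer_group" "\<forall>b\<in>A. f b = 1"
    using C.free_basis_extend[OF A group_integer_group, of "\<lambda>_. 1"] by auto
  interpret f: group_hom "G\<lparr>carrier := C\<rparr>" integer_group f
    using f(1) C.is_group by (simp add: group_hom_def group_hom_axioms_def)
  have "int n * f x = f (x [^]\<^bsub>G\<lparr>carrier := C\<rparr>\<^esub> n)"
    using f.hom_nat_pow[of x n] xC by simp
  also have "x [^]\<^bsub>G\<lparr>carrier := C\<rparr>\<^esub> n = \<one>\<^bsub>G\<lparr>carrier := C\<rparr>\<^esub>"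
    using pow nat_pow_consistent[of x n C] by simp
  also have "f \<dots> = 0" using f.hom_one by (simp only: one_integer_group)
  finally have fx: "f x = 0" using n by simp
  have zero: "(\<lambda>_. 0) \<in> hom (G\<lparr>carrier := C\<rparr>) integer_group" by (simp add: hom_def)
  have aC: "a \<in> generate (G\<lparr>carrier := C\<rparr>) {x}"
    using genC C.free_basisD(1)[OF A] a by auto
  have "f a = 0"
    by (rule hom_eq_on_generate[OF C.is_group group_integer_group f(1) zero _ _ aC]) (use xC fx in simp_all)
  then show False using f(2) a by simp
qed

section \<open>Ascending chains of subgroups of bounded rank\<close>

lemma (in group) bounded_rank_chain:
  assumes B: "free_basis G B" and K: "\<And>i. subgroup (K i) G" "\<And>i. K i \<subset> K (Suc i)"
    and T: "\<And>i :: nat. \<exists>T. finite T \<and> card T \<le> n \<and> T \<subseteq> carrier G \<and> K i = generate G T"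
  shows False
proof -
  define U where "U = (\<Union>i. K i)"
  have mono: "K i \<subseteq> K j" if "i \<le> j" for i j by (rule lift_Suc_mono_le[OF _ that]) (use K(2) in auto)
  have U: "subgroup U G"
  proof (rule subgroupI)
    show "U \<subseteq> carrier G" using subgroup.subset[OF K(1)] by (auto simp: U_def)
    show "U \<noteq> {}" using subgroup.one_closed[OF K(1)] by (auto simp: U_def)
    show "inv x \<in> U" if "x \<in> U" for x using that subgroup.m_inv_closed[OF K(1)] by (auto simp: U_def)
    fix x y assume "x \<in> U" "y \<in> U"
    then obtain i j where "x \<in> K i" "y \<in> K j" by (auto simp: U_def)
    then have "x \<in> K (max i j)" "y \<in> K (max i j)" using mono[of i "max i j"] mono[of j "max i j"] by auto
    then show "x \<otimes> y \<in> U" using subgroup.m_closed[OF K(1)] by (auto simp: U_def)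
  qed
  interpret U: group "G\<lparr>carrier := U\<rparr>" using subgroup_imp_group[OF U] .
  obtain A where A: "free_basis (G\<lparr>carrier := U\<rparr>) A" using nielsen_schreier[OF B U] by blast
  have AU: "A \<subseteq> U" and genA: "generate G A = U"
    using U.free_basisD(1,2)[OF A] generate_consistent[OF _ U] by auto
  have ex: "\<exists>i. A' \<subseteq> K i" if "finite A'" "A' \<subseteq> U" for A'
    using that
  proof (induction A')
    case (insert a A')
    then obtain i j where "A' \<subseteq> K i" "a \<in> K j" by (auto simp: U_def)
    then have "insert a A' \<subseteq> K (max i j)" using mono[of i "max i j"] mono[of j "max i j"] by auto
    then show ?case ..
  qed simp
  have bound: "card A' \<le> n" if A': "finite A'" "A' \<subseteq> A" for A'
  proof -
    obtain i where i: "A' \<subseteq> K i" using ex[of A'] A' AU by blast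
    obtain T where T: "finite T" "card T \<le> n" "T \<subseteq> carrier G" "K i = generate G T" using T by blast
    have "T \<subseteq> U" using T(4) generate.incl[of _ T G] by (auto simp: U_def)
    then have "A' \<subseteq> generate (G\<lparr>carrier := U\<rparr>) T" using i T(4) generate_consistent[OF _ U] by simp
    then have "card A' \<le> card T" using A' T \<open>T \<subseteq> U\<close> by (intro U.card_free_basis_le[OF A]) auto
    then show ?thesis using T(2) by simp
  qed
  have "finite A"
  proof (rule ccontr)
    assume "infinite A"
    then obtain A' where "A' \<subseteq> A" "finite A'" "card A' = Suc n" using infinite_arbitrarily_large by blast
    then show False using bound[of A'] by simp
  qed
  \<comment> \<open>A finite basis already lies in one member, so the chain would be constant from
    there on.\<close>
  then obtain i where "A \<subseteq> K i" using ex AU by blast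
  then have "U \<subseteq> K i" using generate_subgroup_incl[OF _ K(1)] genA by blast
  then show False using K(2)[of i] by (auto simp: U_def)
qed

section \<open>Equations over a free factor\<close>

definition fp_lift ::
  "('c, 'd) monoid_scheme \<Rightarrow> ('a \<Rightarrow> 'c) \<Rightarrow> ('b \<Rightarrow> 'c) \<Rightarrow> ('a + 'b) list \<Rightarrow> 'c"
where
  "fp_lift K \<alpha> \<beta> w = foldr (\<lambda>a u. case_sum \<alpha> \<beta> a \<otimes>\<^bsub>K\<^esub> u) w \<one>\<^bsub>K\<^esub>"

lemma fp_lift_simps [simp]:
  "fp_lift K \<alpha> \<beta> [] = \<one>\<^bsub>K\<^esub>"
  "fp_lift K \<alpha> \<beta> (a # w) = case_sum \<alpha> \<beta> a \<otimes>\<^bsub>K\<^esub> fp_lift K \<alpha> \<beta> w"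
  by (simp_all add: fp_lift_def)

text \<open>All reduces to prepending one syllable: merging it with a head from the same factor, or
  deleting the two when they cancel, preserves the value because \<open>\<alpha>\<close> and
  \<open>\<beta>\<close> are homomorphisms.\<close>

lemma fp_lift_hom:
  assumes G: "group G" and H: "group H" and K: "group K"
    and \<alpha>: "\<alpha> \<in> hom G K" and \<beta>: "\<beta> \<in> hom H K"
  shows "fp_lift K \<alpha> \<beta> \<in> hom (free_product G H) K"
proof (rule homI)
  interpret a: group_hom G K \<alpha> using G K \<alpha> by (simp add: group_hom_def group_hom_axioms_def)
  interpret b: group_hom H K \<beta> using H K \<beta> by (simp add: group_hom_def group_hom_axioms_def)
  let ?P = "free_product G H"
  let ?f = "fp_lift K \<alpha> \<beta>"
  have cl: "?f w \<in> carrier K" if "set w \<subseteq> Inl ` carrier G \<union> Inr ` carrier H" for w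
    using that by (induction w) auto
  have st: "set w \<subseteq> Inl ` carrier G \<union> Inr ` carrier H" if "w \<in> carrier ?P" for w
    by (rule free_product_set[OF G H that])
  show "?f x \<in> carrier K" if "x \<in> carrier ?P" for x using cl[OF st[OF that]] .
  have inl: "?f (fp_inl G g @ v) = \<alpha> g \<otimes>\<^bsub>K\<^esub> ?f v"
    and inr: "?f (fp_inr H h @ v) = \<beta> h \<otimes>\<^bsub>K\<^esub> ?f v"
    if "set v \<subseteq> Inl ` carrier G \<union> Inr ` carrier H" for g h v
    using cl[OF that] by (simp_all add: fp_inl_def fp_inr_def)
  have step: "?f (fp_cons G H a w) = ?f (a # w)"
    if a: "a \<in> Inl ` carrier G \<union> Inr ` carrier H" and w: "set w \<subseteq> Inl ` carrier G \<union> Inr ` carrier H"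
    for a w
  proof (cases "\<exists>b v. w = b # v \<and> isl a = isl b")
    case True
    then obtain b v where wb: "w = b # v" "isl a = isl b" by blast
    have b: "b \<in> Inl ` carrier G \<union> Inr ` carrier H" and v: "set v \<subseteq> Inl ` carrier G \<union> Inr ` carrier H"
      using w wb(1) by simp_all
    note fv = cl[OF v]
    show ?thesis
    proof (cases a)
      case (Inl g)
      then obtain g' where "b = Inl g'" "g \<in> carrier G" "g' \<in> carrier G" using a b wb(2) by auto
      then show ?thesis using Inl wb(1) fv by (simp add: inl[OF v] a.H.m_assoc)
    next
      case (Inr h)
      then obtain h' where "b = Inr h'" "h \<in> carrier H" "h' \<in> carrier H" using a b wb(2) by auto
      then show ?thesis using Inr wb(1) fv by (simp add: inr[OF v] a.H.m_assoc)
    qed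
  next
    case False
    then have "fp_cons G H a w = (case a of Inl g \<Rightarrow> fp_inl G g @ w | Inr h \<Rightarrow> fp_inr H h @ w)"
      by (cases a; cases w; cases "hd w") auto
    then show ?thesis using inl[OF w] inr[OF w] by (cases a) simp_all
  qed
  fix x y assume xy: "x \<in> carrier ?P" "y \<in> carrier ?P"
  have "?f (foldr (fp_cons G H) x y) = ?f x \<otimes>\<^bsub>K\<^esub> ?f y"
    if "set x \<subseteq> Inl ` carrier G \<union> Inr ` carrier H" using that
  proof (induction x)
    case Nil
    then show ?case using cl[OF st[OF xy(2)]] by simp
  next
    case (Cons a x)
    have "foldr (fp_cons G H) x y \<in> carrier ?P"
      using Cons.prems xy by (intro foldr_fp_cons_closed G H) auto
    then have "?f (foldr (fp_cons G H) (a # x) y) = ?f (a # foldr (fp_cons G H) x y)"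
      using step st Cons.prems by simp
    moreover have "?f x \<in> carrier K" "?f y \<in> carrier K" using Cons.prems cl st[OF xy(2)] by auto
    moreover have "case_sum \<alpha> \<beta> a \<in> carrier K" using Cons.prems by auto
    ultimately show ?case using Cons by (simp add: a.H.m_assoc)
  qed
  then show "?f (x \<otimes>\<^bsub>?P\<^esub> y) = ?f x \<otimes>\<^bsub>K\<^esub> ?f y"
    using st[OF xy(1)] by (simp add: free_product_def)
qed

lemma one_free_product [simp]: "\<one>\<^bsub>free_product G H\<^esub> = []"
  by (simp add: free_product_def)

lemma one_adjoin_var [simp]: "\<one>\<^bsub>adjoin_var G L\<^esub> = []"
  by (simp add: adjoin_var_def)

lemma fp_inl_carrier [simp]: "fp_inl (G\<lparr>carrier := L\<rparr>) = fp_inl G"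
  by (simp add: fp_inl_def fun_eq_iff)

lemma (in group) group_adjoin_var: "subgroup L G \<Longrightarrow> group (adjoin_var G L)"
  unfolding adjoin_var_def
  by (rule group_free_product[OF subgroup_imp_group group_integer_group])

lemma (in group) fp_inl_hom_adjoin_var:
  "subgroup L G \<Longrightarrow> fp_inl G \<in> hom (G\<lparr>carrier := L\<rparr>) (adjoin_var G L)"
  using fp_inl_hom[OF subgroup_imp_group group_integer_group, of L]
  by (simp add: adjoin_var_def)

lemma fp_inr_in_adjoin_var: "fp_inr integer_group n \<in> carrier (adjoin_var G L)"
  by (simp add: adjoin_var_def free_product_def fp_inr_def)

lemma fp_inl_in_adjoin_var: "g \<in> L \<Longrightarrow> fp_inl G g \<in> carrier (adjoin_var G L)"
  by (simp add: adjoin_var_def free_product_def fp_inl_def)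

lemma subst_var_image:
  assumes "x \<in> A" "\<And>i. h i \<in> A"
  shows "subst_var x h ` V \<subseteq> A"
  using assms by (auto simp: subst_var_def split: eq_var.split)

lemma subst_var_comp: "f (subst_var x h v) = subst_var (f x) (\<lambda>i. f (h i)) v"
  by (simp add: subst_var_def split: eq_var.split)

lemma hom_word_eval_subst:
  assumes "group G" "group G'" "f \<in> hom G G'" "x \<in> carrier G" "\<And>i. h i \<in> carrier G"
  shows "f (word_eval G (subst_var x h) e) = word_eval G' (subst_var (f x) (\<lambda>i. f (h i))) e"
  using hom_word_eval[OF assms(1-3) subst_var_image[OF assms(4,5)]] by (simp add: subst_var_comp)

text \<open>Substitution of x for the variable. The target \<open>K\<close> and the map
  \<open>\<alpha>\<close> on coefficients are left open because the lemma serves both for evaluation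
  in \<open>G\<close> and for a change of variable inside \<open>adjoin_var G L\<close>.\<close>

lemma (in group) eval_adjoin_var_hom:
  assumes L: "subgroup L G" and K: "group K" and \<alpha>: "\<alpha> \<in> hom (G\<lparr>carrier := L\<rparr>) K"
    and x: "x \<in> carrier K"
  defines "ev \<equiv> fp_lift K \<alpha> (\<lambda>n :: int. x [^]\<^bsub>K\<^esub> n)"
  shows "ev \<in> hom (adjoin_var G L) K"
    and "ev (fp_inr integer_group 1) = x"
    and "g \<in> L \<Longrightarrow> ev (fp_inl G g) = \<alpha> g"
proof -
  interpret K: group K by (rule K)
  interpret a: group_hom "G\<lparr>carrier := L\<rparr>" K \<alpha>
    using subgroup_imp_group[OF L] K \<alpha> by (simp add: group_hom_def group_hom_axioms_def)
  show "ev \<in> hom (adjoin_var G L) K"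
    unfolding ev_def adjoin_var_def
    by (intro fp_lift_hom subgroup_imp_group L group_integer_group K \<alpha> K.hom_integer_group_pow x)
  show "ev (fp_inr integer_group 1) = x" using x by (simp add: ev_def fp_inr_def)
  show "ev (fp_inl G g) = \<alpha> g" if "g \<in> L" using that a.hom_one a.hom_closed by (auto simp: ev_def fp_inl_def)
qed

section \<open>Normal forms in a torsion-free free product\<close>

locale torsion_free_free_product = group G for G (structure) +
  fixes L M
  assumes ifp: "internal_free_product G L M"
    and torsion_free: "\<And>x n. x \<in> carrier G \<Longrightarrow> x \<noteq> \<one> \<Longrightarrow> n > 0 \<Longrightarrow> x [^] (n :: nat) \<noteq> \<one>"
begin

definition val :: "'a + 'a \<Rightarrow> 'a" where "val = case_sum (\<lambda>g. g) (\<lambda>h. h)"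

text \<open>Indexing the two factors by the value of \<open>isl\<close> lets an induction swap their
  roles, as stripping a conjugation does in \<open>both_ends_pow\<close>.\<close>

definition factor :: "bool \<Rightarrow> 'a set" where "factor s = (if s then L else M)"

definition nf :: "('a + 'a) list \<Rightarrow> bool" where
  "nf w \<longleftrightarrow> (\<forall>a\<in>set w. val a \<in> factor (isl a) \<and> val a \<noteq> \<one>) \<and> successively (\<lambda>a b. isl a \<noteq> isl b) w"

lemma subgroups: "subgroup L G" "subgroup M G"
  using ifp by (simp_all add: internal_free_product_def)

lemma subgroup_factor: "subgroup (factor s) G"
  using subgroups by (simp add: factor_def)

lemma factor_carrier: "factor s \<subseteq> carrier G"
  using subgroup.subset[OF subgroup_factor] .

lemma nf_carrier: "nf w \<longleftrightarrow> w \<in> carrier (free_product (G\<lparr>carrier := L\<rparr>) (G\<lparr>carrier := M\<rparr>))"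
proof -
  have "val a \<in> factor (isl a) \<and> val a \<noteq> \<one> \<longleftrightarrow> a \<in> Inl ` (L - {\<one>}) \<union> Inr ` (M - {\<one>})" for a
    by (cases a) (auto simp: val_def factor_def)
  then show ?thesis by (auto simp: nf_def free_product_def)
qed

lemma nf_bij: "bij_betw (fp_eval G) (Collect nf) (carrier G)"
proof -
  have "Collect nf = carrier (free_product (G\<lparr>carrier := L\<rparr>) (G\<lparr>carrier := M\<rparr>))"
    using nf_carrier by blast
  then show ?thesis using ifp by (simp add: internal_free_product_def iso_def)
qed

lemma nf_ex: "x \<in> carrier G \<Longrightarrow> \<exists>w. nf w \<and> fp_eval G w = x"
  using nf_bij unfolding bij_betw_def by (metis (no_types, lifting) imageE mem_Collect_eq)

lemma nf_one:
  assumes "nf w" "fp_eval G w = \<one>"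
  shows "w = []"
proof -
  have "nf []" "fp_eval G [] = \<one>" by (simp_all add: nf_def fp_eval_def)
  then show ?thesis using assms inj_onD[of "fp_eval G" "Collect nf" w "[]"] nf_bij
    by (simp add: bij_betw_def)
qed

lemma fp_eval_simps [simp]: "fp_eval G [] = \<one>" "fp_eval G (a # w) = val a \<otimes> fp_eval G w"
  by (simp_all add: fp_eval_def val_def)

lemma val_closed: "nf w \<Longrightarrow> a \<in> set w \<Longrightarrow> val a \<in> carrier G"
  using factor_carrier by (auto simp: nf_def)

lemma fp_eval_closed: "set w \<subseteq> {a. val a \<in> carrier G} \<Longrightarrow> fp_eval G w \<in> carrier G"
  by (induction w) auto

lemma nf_closed: "nf w \<Longrightarrow> fp_eval G w \<in> carrier G"
  using val_closed by (intro fp_eval_closed) blast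

lemma fp_eval_append:
  assumes "set u \<subseteq> {a. val a \<in> carrier G}" "set v \<subseteq> {a. val a \<in> carrier G}"
  shows "fp_eval G (u @ v) = fp_eval G u \<otimes> fp_eval G v"
  using assms by (induction u) (auto simp: fp_eval_closed m_assoc)

lemma nf_append:
  "nf (u @ v) \<longleftrightarrow> nf u \<and> nf v \<and> (u = [] \<or> v = [] \<or> isl (last u) \<noteq> isl (hd v))"
  by (auto simp: nf_def successively_append_iff)

lemma nf_Cons:
  "nf (a # v) \<longleftrightarrow> val a \<in> factor (isl a) \<and> val a \<noteq> \<one> \<and> nf v \<and> (v = [] \<or> isl a \<noteq> isl (hd v))"
  by (cases v) (auto simp: nf_def)

lemma nf_eval_append:
  "nf u \<Longrightarrow> nf v \<Longrightarrow> fp_eval G (u @ v) = fp_eval G u \<otimes> fp_eval G v"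
  using val_closed by (intro fp_eval_append) auto

definition letter :: "bool \<Rightarrow> 'a \<Rightarrow> 'a + 'a" where "letter s g = (if s then Inl g else Inr g)"

lemma letter_simps [simp]: "val (letter s g) = g" "isl (letter s g) = s"
  by (simp_all add: letter_def val_def)

definition both_ends :: "bool \<Rightarrow> ('a + 'a) list \<Rightarrow> bool" where
  "both_ends s w \<longleftrightarrow> nf w \<and> w \<noteq> [] \<and> isl (hd w) = s \<and> isl (last w) = s"

text \<open>A single syllable has non-trivial powers by torsion-freeness. Otherwise w = a u b. If b
  a is non-trivial, the power is a u (b a) u ... (b a) u b, already in normal form. If b a is
  trivial, the power is the conjugate by a of a power of u, which is shorter and has both ends in
  the other factor.\<close>

lemma both_ends_pow:
  assumes "both_ends s w" "n > 0"
  shows "\<exists>v. both_ends s v \<and> fp_eval G v = fp_eval G w [^] (n :: nat)"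
  using assms
proof (induction "length w" arbitrary: w s rule: less_induct)
  case less
  then have w: "nf w" "w \<noteq> []" "isl (hd w) = s" "isl (last w) = s" by (simp_all add: both_ends_def)
  then obtain a t where at: "w = a # t" by (cases w) auto
  have a: "val a \<in> factor s" "val a \<noteq> \<one>" "isl a = s" using w at by (auto simp: nf_Cons)
  have ac: "val a \<in> carrier G" using a factor_carrier by blast
  show ?case
  proof (cases t rule: rev_cases)
    case Nil
    interpret f: subgroup "factor s" G by (rule subgroup_factor)
    have "val a [^] n \<in> factor s" using a by (induction n) auto
    then have "both_ends s [letter s (val a [^] n)]"
      using torsion_free[OF ac a(2) less.prems(2)] by (simp add: both_ends_def nf_Cons nf_def)
    moreover have "fp_eval G [letter s (val a [^] n)] = fp_eval G w [^] n" using Nil at ac by simp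
    ultimately show ?thesis by blast
  next
    case (snoc u b)
    have w': "w = a # u @ [b]" using at snoc by simp
    have b: "val b \<in> factor s" "val b \<noteq> \<one>" "isl b = s" using w w' by (auto simp: nf_Cons nf_append)
    have bc: "val b \<in> carrier G" using b factor_carrier by blast
    have ub: "nf (u @ [b])" "isl (hd (u @ [b])) \<noteq> s" using w(1) a(3) by (simp_all add: w' nf_Cons)
    then have u: "u \<noteq> []" using b(3) by auto
    with ub b(3) have u: "u \<noteq> []" "nf u" "isl (hd u) = (\<not> s)" "isl (last u) = (\<not> s)"
      by (simp_all add: nf_append)
    have uc: "fp_eval G u \<in> carrier G" using nf_closed[OF u(2)] .
    have nfb: "nf [b]" using b by (simp add: nf_Cons nf_def)
    have wv: "fp_eval G w = val a \<otimes> (fp_eval G u \<otimes> val b)"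
      using nf_eval_append[OF u(2) nfb] bc by (simp add: w')
    define c where "c = val b \<otimes> val a"
    have c: "c \<in> factor s" using a b subgroup.m_closed[OF subgroup_factor] by (simp add: c_def)
    show ?thesis
    proof (cases "c = \<one>")
      case True
      then have ba: "val b = inv (val a)" unfolding c_def using ac bc by (intro inv_equality[symmetric])
      have "both_ends (\<not> s) u" using u by (simp add: both_ends_def)
      then obtain v where v: "both_ends (\<not> s) v" "fp_eval G v = fp_eval G u [^] n"
        using less.hyps[OF _ _ less.prems(2), of u "\<not> s"] w' by force
      have conj: "(val a \<otimes> (fp_eval G u \<otimes> val b)) [^] k = val a \<otimes> (fp_eval G u [^] k \<otimes> val b)" for k :: nat
        using uc ac by (induction k) (simp_all add: ba m_assoc m_inv_cancel)
      have vn: "nf v" using v(1) by (simp add: both_ends_def)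
      have "both_ends s (a # v @ [b])"
        using v(1) a b nfb by (auto simp: both_ends_def nf_Cons nf_append hd_append)
      moreover have "fp_eval G (a # v @ [b]) = fp_eval G w [^] n"
        using nf_eval_append[OF vn nfb] bc v(2) by (simp add: wv conj)
      ultimately show ?thesis by blast
    next
      case False
      \<comment> \<open>The claim fixes the first syllable \<open>a\<close>, because the next copy
        of \<open>w\<close> on the left merges its last syllable with it into
        \<open>c\<close>.\<close>
      have "\<exists>t. both_ends s (a # t) \<and> fp_eval G (a # t) = fp_eval G w [^] n"
        using less.prems(2)
      proof (induction n rule: nat_induct_non_zero)
        case 1
        then show ?case using less.prems(1) at nf_closed[OF w(1)] by (intro exI[of _ t]) simp
      next
        case (Suc n)
        then obtain t' where t': "both_ends s (a # t')" "fp_eval G (a # t') = fp_eval G w [^] n" by blast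
        have tn: "nf t'" using t'(1) by (simp add: both_ends_def nf_Cons)
        have tc: "fp_eval G t' \<in> carrier G" using nf_closed[OF tn] .
        have ct: "nf (letter s c # t')" using t' c False a by (auto simp: both_ends_def nf_Cons)
        have "both_ends s (a # u @ letter s c # t')"
          using t'(1) ct u a unfolding both_ends_def by (auto simp: nf_Cons nf_append hd_append)
        moreover have "fp_eval G (a # u @ letter s c # t') = fp_eval G w [^] Suc n"
        proof -
          have "fp_eval G (a # u @ letter s c # t') = fp_eval G w \<otimes> (val a \<otimes> fp_eval G t')"
            using nf_eval_append[OF u(2) ct] uc ac bc tc by (simp add: wv c_def m_assoc)
          also have "\<dots> = fp_eval G w \<otimes> fp_eval G w [^] n" using t'(2) by simp
          also have "\<dots> = fp_eval G w [^] Suc n" using nf_closed[OF w(1)] by (rule nat_pow_Suc2[symmetric])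
          finally show ?thesis .
        qed
        ultimately show ?case by blast
      qed
      then show ?thesis by blast
    qed
  qed
qed

lemma both_ends_inv:
  assumes "both_ends s w"
  shows "\<exists>v. both_ends s v \<and> fp_eval G v = inv (fp_eval G w)"
proof -
  have w: "nf w" "w \<noteq> []" "isl (hd w) = s" "isl (last w) = s" using assms by (simp_all add: both_ends_def)
  define i where "i a = letter (isl a) (inv (val a))" for a
  define v where "v = rev (map i w)"
  have i: "isl (i a) = isl a" "val (i a) = inv (val a)" for a by (simp_all add: i_def)
  have inv_eval: "fp_eval G (rev (map i u)) = inv (fp_eval G u)" if "set u \<subseteq> {a. val a \<in> carrier G}" for u
    using that
  proof (induction u)
    case (Cons a u)
    have "set (rev (map i u)) \<subseteq> {a. val a \<in> carrier G}" using Cons.prems by (auto simp: i)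
    then have "fp_eval G (rev (map i u) @ [i a]) = fp_eval G (rev (map i u)) \<otimes> fp_eval G [i a]"
      using Cons.prems by (intro fp_eval_append) (auto simp: i)
    then show ?case using Cons by (simp add: i inv_mult_group fp_eval_closed)
  qed simp
  have "set w \<subseteq> {a. val a \<in> carrier G}" using val_closed[OF w(1)] by blast
  then have e: "fp_eval G v = inv (fp_eval G w)" unfolding v_def by (rule inv_eval)
  have "successively (\<lambda>a b. isl a \<noteq> isl b) v"
    using w(1) unfolding v_def nf_def successively_rev successively_map i
    by (auto elim: successively_mono)
  moreover have "val (i a) \<in> factor (isl (i a)) \<and> val (i a) \<noteq> \<one>" if "a \<in> set w" for a
  proof -
    have "val a \<in> factor (isl a)" "val a \<noteq> \<one>" using w(1) that by (simp_all add: nf_def)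
    moreover from this have "val a \<in> carrier G" using factor_carrier by blast
    ultimately show ?thesis
      using subgroup.m_inv_closed[OF subgroup_factor] by (simp add: i)
  qed
  ultimately have "nf v" by (auto simp: nf_def v_def)
  then have "both_ends s v"
    using w by (simp add: both_ends_def v_def hd_rev last_rev last_map hd_map i)
  then show ?thesis using e by blast
qed

lemma both_ends_int_pow:
  assumes w: "both_ends s w" and n: "n \<noteq> 0"
  shows "\<exists>v. both_ends s v \<and> fp_eval G v = fp_eval G w [^] (n :: int)"
proof -
  have wc: "fp_eval G w \<in> carrier G" using w nf_closed by (simp add: both_ends_def)
  show ?thesis
  proof (cases "n > 0")
    case True
    then obtain k where k: "n = int k" "k > 0" by (metis zero_less_imp_eq_int)
    show ?thesis using both_ends_pow[OF w k(2)] unfolding k(1) int_pow_int .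
  next
    case False
    then obtain k where k: "n = - int k" "k > 0" using n by (metis linorder_neqE_linordered_idom neg_0_less_iff_less add.inverse_inverse zero_less_imp_eq_int)
    obtain v where v: "both_ends s v" "fp_eval G v = fp_eval G w [^] k"
      using both_ends_pow[OF w k(2)] by blast
    show ?thesis using both_ends_inv[OF v(1)] unfolding v(2) k(1) int_pow_neg_int[OF wc] .
  qed
qed

text \<open>Non-zero powers of y begin and end in \<open>M\<close>, so writing their normal forms in
  place of the powers of X gives a word that is already in normal form: no cancellation can occur.
  The clause on heads is what the induction needs to glue the pieces.\<close>

lemma eval_normal_form:
  assumes y: "both_ends False w" and q: "q \<in> carrier (adjoin_var G L)"
  shows "\<exists>v. nf v \<and> fp_eval G v = fp_lift G (\<lambda>g. g) (\<lambda>n :: int. fp_eval G w [^] n) q \<and>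
     (v = [] \<longleftrightarrow> q = []) \<and> (q \<noteq> [] \<longrightarrow> isl (hd v) = isl (hd q))"
  using q
proof (induction q)
  case Nil
  show ?case by (rule exI[of _ "[]"]) (simp add: nf_def)
next
  case (Cons a q)
  have q: "q \<in> carrier (adjoin_var G L)" and aq: "q = [] \<or> isl a \<noteq> isl (hd q)"
    using Cons.prems by (cases q; simp add: adjoin_var_def free_product_def)+
  let ?f = "fp_lift G (\<lambda>g. g) (\<lambda>n :: int. fp_eval G w [^] n)"
  obtain v where v: "nf v" "fp_eval G v = ?f q" "v = [] \<longleftrightarrow> q = []" "q \<noteq> [] \<longrightarrow> isl (hd v) = isl (hd q)"
    using Cons.IH[OF q] by blast
  show ?case
  proof (cases a)
    case (Inl l)
    then have "l \<in> L" "l \<noteq> \<one>" using Cons.prems by (auto simp: adjoin_var_def free_product_def)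
    then have "nf (Inl l # v)" using v aq Inl by (auto simp: nf_Cons val_def factor_def)
    then show ?thesis using v Inl by (intro exI[of _ "Inl l # v"]) (simp add: val_def)
  next
    case (Inr n)
    then have "n \<noteq> 0" using Cons.prems by (auto simp: adjoin_var_def free_product_def)
    then obtain u where u: "both_ends False u" "fp_eval G u = fp_eval G w [^] n"
      using both_ends_int_pow[OF y] by blast
    then have "nf u" "u \<noteq> []" "isl (hd u) = False" "isl (last u) = False" by (simp_all add: both_ends_def)
    then show ?thesis using v aq Inr u(2)
      by (intro exI[of _ "u @ v"]) (auto simp: nf_append nf_eval_append)
  qed
qed

text \<open>Strip from the normal form of x a first and a last syllable in \<open>L\<close>, where
  present; something is left because x is not in \<open>L\<close>.\<close>

lemma both_ends_decomposition:
  assumes x: "x \<in> carrier G" "x \<notin> L"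
  shows "\<exists>l1\<in>L. \<exists>l2\<in>L. \<exists>w. both_ends False w \<and> x = l1 \<otimes> fp_eval G w \<otimes> l2"
proof -
  interpret L: subgroup L G by (rule subgroups)
  obtain w where w: "nf w" "fp_eval G w = x" using nf_ex[OF x(1)] by blast
  have L_val: "val a \<in> L" if "nf (u @ a # v)" "isl a" for u a v
    using that by (auto simp: nf_append nf_Cons factor_def)
  obtain l1 u where u: "l1 \<in> L" "nf u" "x = l1 \<otimes> fp_eval G u" "u \<noteq> [] \<longrightarrow> \<not> isl (hd u)"
  proof (cases "w \<noteq> [] \<and> isl (hd w)")
    case True
    then obtain a u where au: "w = a # u" "isl a" by (cases w) auto
    then show ?thesis using that[of "val a" u] w L_val[of "[]" a u] by (auto simp: nf_Cons)
  next
    case False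
    then show ?thesis using that[of \<one> w] w x(1) by auto
  qed
  have une: "u \<noteq> []" using u(1,3) x(2) by auto
  show ?thesis
  proof (cases "isl (last u)")
    case True
    obtain t b where tb: "u = t @ [b]" using une by (cases u rule: rev_cases) auto
    then have b: "val b \<in> L" "nf [b]" "nf t" "t \<noteq> []" using True u L_val[of t b "[]"] by (auto simp: nf_append)
    then have "both_ends False t"
      using u True tb by (auto simp: both_ends_def nf_append hd_append)
    moreover have "x = l1 \<otimes> fp_eval G t \<otimes> val b"
      using u b tb nf_eval_append[OF b(3,2)] nf_closed[OF b(3)] by (simp add: m_assoc)
    ultimately show ?thesis using u b by blast
  next
    case False
    then have "both_ends False u" using u une by (simp add: both_ends_def)
    moreover have "x = l1 \<otimes> fp_eval G u \<otimes> \<one>" using u nf_closed[OF u(2)] by simp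
    ultimately show ?thesis using u(1) L.one_closed by blast
  qed
qed

text \<open>Writing \<open>x = l1 \<otimes> y \<otimes> l2\<close> with \<open>y\<close> beginning and ending in \<open>M\<close>, the automorphism of
  \<open>L * \<langle>X\<rangle>\<close> given by \<open>X \<mapsto> l1 X l2\<close> turns the solution \<open>x\<close> into the solution \<open>y\<close>.\<close>

lemma solution_in_factor:
  assumes x: "x \<in> carrier G" and h: "\<And>i. h i \<in> L"
    and nontriv: "particularization G L e h \<noteq> []"
    and sol: "word_eval G (subst_var x h) e = \<one>"
  shows "x \<in> L"
proof (rule ccontr)
  assume "x \<notin> L"
  then obtain l1 l2 w where l: "l1 \<in> L" "l2 \<in> L" and w: "both_ends False w"
    and xw: "x = l1 \<otimes> fp_eval G w \<otimes> l2"
    using both_ends_decomposition x by blast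
  interpret L: subgroup L G by (rule subgroups)
  define A where "A = adjoin_var G L"
  interpret A: group A unfolding A_def by (rule group_adjoin_var[OF subgroups(1)])
  define j :: "'a \<Rightarrow> ('a + int) list" where "j = fp_inl G"
  define X :: "('a + int) list" where "X = fp_inr integer_group 1"
  have j: "j \<in> hom (G\<lparr>carrier := L\<rparr>) A"
    unfolding A_def j_def by (rule fp_inl_hom_adjoin_var[OF subgroups(1)])
  interpret j: group_hom "G\<lparr>carrier := L\<rparr>" A j
    using j subgroup_imp_group[OF subgroups(1)] A.is_group by (simp add: group_hom_def group_hom_axioms_def)
  have X: "X \<in> carrier A" by (simp add: X_def A_def fp_inr_in_adjoin_var)
  have jc [simp]: "j g \<in> carrier A" if "g \<in> L" for g using j.hom_closed that by simp
  \<comment> \<open>\<open>p\<close> is the particularization with X replaced by l1 X l2. The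
    substitution \<open>\<theta>\<close> of \<open>z\<close> for X undoes this and maps
    \<open>p\<close> to the given non-trivial element, so \<open>p\<close> is non-trivial
    too.\<close>
  define p where "p = word_eval A (subst_var (j l1 \<otimes>\<^bsub>A\<^esub> X \<otimes>\<^bsub>A\<^esub> j l2) (\<lambda>i. j (h i))) e"
  define z where "z = inv\<^bsub>A\<^esub> j l1 \<otimes>\<^bsub>A\<^esub> X \<otimes>\<^bsub>A\<^esub> inv\<^bsub>A\<^esub> j l2"
  have z: "z \<in> carrier A" using X l by (simp add: z_def)
  define \<theta> where "\<theta> = fp_lift A j (\<lambda>n :: int. z [^]\<^bsub>A\<^esub> n)"
  note \<theta> = eval_adjoin_var_hom[OF subgroups(1) A.is_group j z, folded \<theta>_def A_def j_def X_def]
  interpret \<theta>: group_hom A A \<theta> using \<theta>(1) A.is_group by (simp add: group_hom_def group_hom_axioms_def)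
  have "\<theta> (j l1 \<otimes>\<^bsub>A\<^esub> X \<otimes>\<^bsub>A\<^esub> j l2) = X"
    using X l z by (simp add: \<theta>(2,3)) (simp add: z_def A.m_assoc A.m_inv_cancel)
  then have "\<theta> p = word_eval A (subst_var X (\<lambda>i. j (h i))) e"
    unfolding p_def using hom_word_eval_subst[OF A.is_group A.is_group \<theta>(1), of _ "\<lambda>i. j (h i)"] X l h
    by (simp add: \<theta>(3))
  then have "\<theta> p \<noteq> \<one>\<^bsub>A\<^esub>" using nontriv by (simp add: particularization_def A_def j_def X_def)
  then have p: "p \<noteq> []" using \<theta>.hom_one by (auto simp: A_def)

  let ?y = "fp_eval G w"
  have y: "?y \<in> carrier G" using w nf_closed by (simp add: both_ends_def)
  \<comment> \<open>Since x = l1 y l2, setting X to y in \<open>p\<close> gives the value of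
    \<open>e\<close> at x, which is trivial; normal forms rule this out for non-trivial
    \<open>p\<close>.\<close>
  define ev where "ev = fp_lift G (\<lambda>g. g) (\<lambda>n :: int. ?y [^] n)"
  have incl: "(\<lambda>g. g) \<in> hom (G\<lparr>carrier := L\<rparr>) G" by (auto simp: hom_def)
  note ev = eval_adjoin_var_hom[OF subgroups(1) is_group incl y, folded ev_def A_def j_def X_def]
  interpret ev: group_hom A G ev using ev(1) A.is_group is_group by (simp add: group_hom_def group_hom_axioms_def)
  have pA: "p \<in> carrier A"
    unfolding p_def using X l h by (intro A.word_eval_closed subst_var_image) auto
  have "ev p = word_eval G (subst_var x h) e"
    unfolding p_def xw using hom_word_eval_subst[OF A.is_group is_group ev(1), of _ "\<lambda>i. j (h i)"] X l h
    by (simp add: ev(2,3))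
  then have "ev p = \<one>" using sol by simp
  moreover from eval_normal_form[OF w pA[unfolded A_def], folded ev_def]
  obtain v where "nf v" "fp_eval G v = ev p" "v = [] \<longleftrightarrow> p = []" by blast
  ultimately show False using nf_one[of v] p by simp
qed

end

section \<open>The closure\<close>

lemma fp_cons_carrier: "fp_cons (G\<lparr>carrier := L\<rparr>) H = fp_cons G H"
proof (intro ext)
  show "fp_cons (G\<lparr>carrier := L\<rparr>) H a w = fp_cons G H a w" for a w
    by (cases a) (simp_all add: fp_cons_simps split: list.split sum.split)
qed

lemma e_algebraic_ext_step:
  assumes "e_algebraic_ext F H K" "elementary_ext F K K'" "algebraic_ext F K K'"
  shows "e_algebraic_ext F H K'"
proof -
  obtain k :: nat and C where C: "C 0 = H" "C k = K"
    "\<forall>i<k. elementary_ext F (C i) (C (Suc i)) \<and> algebraic_ext F (C i) (C (Suc i))"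
    using assms(1) unfolding e_algebraic_ext_def by blast
  show ?thesis
    unfolding e_algebraic_ext_def
    using C assms(2,3)
    by (intro exI[of _ "Suc k"] exI[of _ "C(Suc k := K')"]) (auto simp: less_Suc_eq)
qed

lemma card_of_ordLeq_finite_card:
  assumes "finite A" "finite B" "card A \<le> card B"
  shows "|A| \<le>o |B|"
  unfolding card_of_ordLeq[symmetric] inj_on_iff_card_le[OF assms(1,2)] by (rule assms(3))

section \<open>Monotonicity of solutions and existence of the closure\<close>

context group
begin

text \<open>Normal forms over \<open>H\<close> are normal forms over \<open>K\<close> and are
  multiplied by the same function, so the embedding of one free product in the other is the identity
  on words. Non-triviality thus survives the passage to a larger subgroup.\<close>

lemma particularization_mono:
  assumes H: "subgroup H G" and K: "subgroup K G" and HK: "H \<subseteq> K" and h: "\<And>i. h i \<in> H"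
  shows "particularization G H e h = particularization G K e h"
proof -
  have "Inl ` (H - {\<one>}) \<union> N \<subseteq> Inl ` (K - {\<one>}) \<union> N" for N :: "('a + int) set"
    using HK by blast
  from subset_trans[OF _ this] have "carrier (adjoin_var G H) \<subseteq> carrier (adjoin_var G K)"
    by (simp add: adjoin_var_def free_product_def) blast
  then have "(\<lambda>w. w) \<in> hom (adjoin_var G H) (adjoin_var G K)"
    by (auto simp: hom_def adjoin_var_def free_product_def fp_cons_carrier)
  from hom_word_eval_subst[OF group_adjoin_var[OF H] group_adjoin_var[OF K] this fp_inr_in_adjoin_var fp_inl_in_adjoin_var]
  show ?thesis using h unfolding particularization_def by blast
qed

lemma solution_over_mono:
  assumes "subgroup H G" "subgroup K G" "H \<subseteq> K" "solution_over G H e x"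
  shows "solution_over G K e x"
proof -
  obtain h where h: "\<And>i. h i \<in> H" "particularization G H e h \<noteq> []" "word_eval G (subst_var x h) e = \<one>"
    and x: "x \<in> carrier G"
    using assms(4) by (auto simp: solution_over_def)
  have "particularization G K e h \<noteq> []" using particularization_mono[OF assms(1-3) h(1)] h(2) by simp
  then show ?thesis using x h assms(3) unfolding solution_over_def by (auto intro!: exI[of _ h])
qed

lemma e_closed_Inter:
  assumes "\<C> \<noteq> {}" "\<And>K. K \<in> \<C> \<Longrightarrow> e_closed G E K"
  shows "e_closed G E (\<Inter>\<C>)"
proof -
  have sub: "subgroup (\<Inter>\<C>) G"
    using assms by (intro subgroups_Inter) (auto simp: e_closed_def)
  have "x \<in> K" if "e \<in> E" "solution_over G (\<Inter>\<C>) e x" "K \<in> \<C>" for e x K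
  proof -
    have K: "subgroup K G" "\<And>e x. e \<in> E \<Longrightarrow> solution_over G K e x \<Longrightarrow> x \<in> K"
      using assms(2)[OF that(3)] by (auto simp: e_closed_def)
    show ?thesis using K(2)[OF that(1) solution_over_mono[OF sub K(1) _ that(2)]] that(3) by blast
  qed
  then show ?thesis using sub by (auto simp: e_closed_def)
qed

text \<open>The whole group is closed and closedness passes to intersections, so the
  \<open>LEAST\<close> in \<open>e_closure\<close> is attained, by the intersection of all closed
  subgroups above \<open>H\<close>.\<close>

lemma e_closure:
  assumes H: "subgroup H G"
  shows e_closed_e_closure: "e_closed G E (e_closure G E H)"
    and subset_e_closure: "H \<subseteq> e_closure G E H"
    and e_closure_least: "e_closed G E K \<Longrightarrow> H \<subseteq> K \<Longrightarrow> e_closure G E H \<subseteq> K"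
proof -
  define \<C> where "\<C> = {K. e_closed G E K \<and> H \<subseteq> K}"
  have "carrier G \<in> \<C>"
    using subgroup_self subgroup.subset[OF H] by (auto simp: \<C>_def e_closed_def solution_over_def)
  then have closed: "e_closed G E (\<Inter>\<C>)" by (intro e_closed_Inter) (auto simp: \<C>_def)
  have "e_closure G E H = \<Inter>\<C>"
    unfolding e_closure_def using closed by (intro Least_equality) (auto simp: \<C>_def)
  then show "e_closed G E (e_closure G E H)" "H \<subseteq> e_closure G E H"
    "e_closed G E K \<Longrightarrow> H \<subseteq> K \<Longrightarrow> e_closure G E H \<subseteq> K"
    using closed by (auto simp: \<C>_def)
qed

section \<open>Free factors absorb solutions: algebraicity\<close>

lemma free_factor_solution:
  assumes B: "free_basis G B" and K: "subgroup K G" and L: "free_factor L (G\<lparr>carrier := K\<rparr>)"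
    and H: "subgroup H G" "H \<subseteq> L" and sol: "solution_over G H e x" and x: "x \<in> K"
  shows "x \<in> L" and "subgroup L G"
proof -
  obtain M where ifp: "internal_free_product (G\<lparr>carrier := K\<rparr>) L M" using L by (auto simp: free_factor_def)
  have LK: "subgroup L (G\<lparr>carrier := K\<rparr>)" using ifp by (simp add: internal_free_product_def)
  then show LG: "subgroup L G" by (rule incl_subgroup[OF K])
  have LK': "L \<subseteq> K" using subgroup.subset[OF LK] by simp
  interpret K: group "G\<lparr>carrier := K\<rparr>" using subgroup_imp_group[OF K] .
  \<comment> \<open>The factorization lives in \<open>K\<close>, so normal forms are available only
    for \<open>x\<close> in \<open>K\<close>; torsion-freeness is inherited from
    \<open>G\<close>.\<close>
  interpret torsion_free_free_product "G\<lparr>carrier := K\<rparr>" L M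
  proof
    show "internal_free_product (G\<lparr>carrier := K\<rparr>) L M" by (rule ifp)
    show "y [^]\<^bsub>G\<lparr>carrier := K\<rparr>\<^esub> n \<noteq> \<one>\<^bsub>G\<lparr>carrier := K\<rparr>\<^esub>"
      if "y \<in> carrier (G\<lparr>carrier := K\<rparr>)" "y \<noteq> \<one>\<^bsub>G\<lparr>carrier := K\<rparr>\<^esub>" "n > 0" for y and n :: nat
      using that free_group_torsion_free[OF B, of y n] subgroup.subset[OF K] nat_pow_consistent[of y n K]
      by auto
  qed
  obtain h where h: "\<And>i. h i \<in> L" and part: "particularization G L e h \<noteq> []"
    and one: "word_eval G (subst_var x h) e = \<one>"
    using solution_over_mono[OF H(1) LG H(2) sol] by (auto simp: solution_over_def)
  have "particularization (G\<lparr>carrier := K\<rparr>) L e h = particularization G L e h"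
    by (simp add: particularization_def adjoin_var_def)
  moreover have "word_eval (G\<lparr>carrier := K\<rparr>) (subst_var x h) e = \<one>"
    using word_eval_subgroup[OF K, of "subst_var x h" e] subst_var_image[of x K h] x h LK' one by auto
  ultimately show "x \<in> L" using solution_in_factor[of x h e] x h part by simp
qed

text \<open>A free factor \<open>L\<close> of the closure that contains \<open>H\<close> is itself
  closed: a solution over \<open>L\<close> is one over the closure, so it lies in the closure, and
  then in \<open>L\<close>. Minimality does the rest.\<close>

lemma algebraic_e_closure:
  assumes B: "free_basis G B" and H: "subgroup H G"
  shows "algebraic_ext G H (e_closure G E H)"
proof -
  let ?K = "e_closure G E H"
  have K: "subgroup ?K G" "\<And>e x. e \<in> E \<Longrightarrow> solution_over G ?K e x \<Longrightarrow> x \<in> ?K"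
    using e_closed_e_closure[OF H, of E] by (auto simp: e_closed_def)
  have "?K \<subseteq> L" if L: "free_factor L (G\<lparr>carrier := ?K\<rparr>)" "H \<subseteq> L" for L
  proof (rule e_closure_least[OF H _ L(2)])
    have LK: "L \<subseteq> ?K"
      using L(1) subgroup.subset[of L "G\<lparr>carrier := ?K\<rparr>"] by (auto simp: free_factor_def internal_free_product_def)
    have LG: "subgroup L G"
      using L(1) incl_subgroup[OF K(1)] by (auto simp: free_factor_def internal_free_product_def)
    have "x \<in> L" if "e \<in> E" "solution_over G L e x" for e x
      using free_factor_solution(1)[OF B K(1) L(1) LG subset_refl that(2)]
        K(2)[OF that(1) solution_over_mono[OF LG K(1) LK that(2)]] by blast
    then show "e_closed G E L" using LG by (simp add: e_closed_def)
  qed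
  then show ?thesis
    using H K(1) subset_e_closure[OF H] unfolding algebraic_ext_def extension_def by blast
qed

text \<open>A free factor that contains \<open>H\<close> absorbs the solution x, and with it all
  generators.\<close>

lemma algebraic_adjoin_solution:
  assumes B: "free_basis G B" and H: "subgroup H G" and sol: "solution_over G H e x"
  shows "algebraic_ext G H (generate G (insert x H))"
proof -
  let ?K = "generate G (insert x H)"
  have sub: "insert x H \<subseteq> carrier G"
    using sol subgroup.subset[OF H] by (auto simp: solution_over_def)
  have K: "subgroup ?K G" by (rule generate_is_subgroup[OF sub])
  have gen: "insert x H \<subseteq> ?K" by (intro subsetI generate.incl)
  have "?K \<subseteq> L" if L: "free_factor L (G\<lparr>carrier := ?K\<rparr>)" "H \<subseteq> L" for L
  proof (rule generate_subgroup_incl)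
    have "x \<in> ?K" "H \<subseteq> ?K" using gen by simp_all
    note L' = free_factor_solution[OF B K L(1) H L(2) sol \<open>x \<in> ?K\<close>]
    show "subgroup L G" by (rule L'(2))
    show "insert x H \<subseteq> L" using L'(1) L(2) by simp
  qed
  then show ?thesis
    using H K gen unfolding algebraic_ext_def extension_def by blast
qed

section \<open>Rank bound and termination for finitely generated subgroups\<close>

lemma finite_free_basis:
  assumes B: "free_basis G B" and T: "finite T" "T \<subseteq> carrier G" "generate G T = carrier G"
  shows "finite B \<and> card B \<le> card T"
proof -
  have le: "card B' \<le> card T" if "B' \<subseteq> B" "finite B'" for B'
    using card_free_basis_le[OF B that T(1,2)] that(1) free_basisD(1)[OF B] T(3) by auto
  have "finite B"
  proof (rule ccontr)
    assume "infinite B"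
    then obtain B' where "B' \<subseteq> B" "finite B'" "card B' = Suc (card T)"
      using infinite_arbitrarily_large by blast
    then show False using le[of B'] by simp
  qed
  then show ?thesis using le by blast
qed

text \<open>Spell the coefficients in the basis \<open>A\<close> and use x itself as the letter for
  X; as x is outside \<open>K\<close>, it is a letter distinct from those of \<open>A\<close>. The
  resulting word is non-empty because \<open>\<theta>\<close> maps it to the non-trivial
  particularization, and its value in \<open>G\<close> is that of the solved equation.\<close>

lemma solution_relation:
  assumes K: "subgroup K G" and A: "free_basis (G\<lparr>carrier := K\<rparr>) A" and x: "x \<notin> K"
    and sol: "solution_over G K e x"
  shows "\<exists>q\<in>carrier (free_group (insert x A)). q \<noteq> [] \<and> word_eval G (\<lambda>s. s) q = \<one>"
proof -
  let ?K = "G\<lparr>carrier := K\<rparr>" and ?FG = "free_group (insert x A)"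
  interpret K: group ?K using subgroup_imp_group[OF K] .
  interpret FG: group ?FG by (rule group_free_group)
  obtain h where h: "\<And>i. h i \<in> K" and part: "particularization G K e h \<noteq> []"
    and one: "word_eval G (subst_var x h) e = \<one>" and xG: "x \<in> carrier G"
    using sol by (auto simp: solution_over_def)
  have AK: "A \<subseteq> K" using K.free_basisD(1)[OF A] by simp
  have AG: "A \<subseteq> carrier G" using AK subgroup.subset[OF K] by blast
  have "word_eval ?K (\<lambda>b. b) ` carrier (free_group A) = K"
    using A by (simp add: free_basis_def iso_def bij_betw_def)
  then have "\<exists>w. w \<in> carrier (free_group A) \<and> word_eval ?K (\<lambda>b. b) w = h i" for i
    using h[of i] by (metis imageE)
  then obtain w where w: "\<And>i. w i \<in> carrier (free_group A)" "\<And>i. word_eval ?K (\<lambda>b. b) (w i) = h i"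
    by metis
  have wA: "fst ` set (w i) \<subseteq> A" for i using w(1)[of i] by (simp add: carrier_free_group)
  have wFG: "w i \<in> carrier ?FG" for i using w(1)[of i] by (auto simp: carrier_free_group)
  have xFG: "[(x, True)] \<in> carrier ?FG" by simp
  define q where "q = word_eval ?FG (subst_var [(x, True)] w) e"
  have qFG: "q \<in> carrier ?FG"
    unfolding q_def by (intro FG.word_eval_closed subst_var_image xFG wFG)

  let ?P = "adjoin_var G K"
  interpret P: group ?P by (rule group_adjoin_var[OF K])
  define \<theta> where "\<theta> s = (if s = x then fp_inr integer_group 1 else fp_inl G s)" for s
  have \<theta>: "\<theta> \<in> insert x A \<rightarrow> carrier ?P"
    using AK by (auto simp: \<theta>_def fp_inr_in_adjoin_var intro!: fp_inl_in_adjoin_var)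
  have "word_eval ?P \<theta> (w i) = fp_inl G (h i)" for i
  proof -
    have "word_eval ?P \<theta> (w i) = word_eval ?P (fp_inl G) (w i)"
      using wA[of i] AK x by (intro word_eval_cong) (auto simp: \<theta>_def)
    also have "\<dots> = fp_inl G (word_eval ?K (\<lambda>b. b) (w i))"
      using hom_word_eval[OF K.is_group P.is_group fp_inl_hom_adjoin_var[OF K], of "\<lambda>b. b" "w i"] wA[of i] AK
      by auto
    finally show ?thesis using w(2) by simp
  qed
  moreover have "word_eval ?P \<theta> [(x, True)] = fp_inr integer_group 1"
    using fp_inr_in_adjoin_var[of 1 G K] by (simp add: \<theta>_def del: one_adjoin_var)
  ultimately have "word_eval ?P \<theta> q = particularization G K e h"
    unfolding q_def particularization_def
    using hom_word_eval_subst[where h = w and e = e, OF FG.is_group P.is_group P.word_eval_hom[OF \<theta>] xFG wFG] by simp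
  then have "q \<noteq> []" using part by auto

  have incl: "(\<lambda>s. s) \<in> insert x A \<rightarrow> carrier G" using xG AG by auto
  have "word_eval G (\<lambda>s. s) (w i) = h i" for i
    using word_eval_subgroup[OF K, of "\<lambda>b. b" "w i"] wA[of i] AK w(2)[of i] by auto
  then have "word_eval G (\<lambda>s. s) q = word_eval G (subst_var x h) e"
    unfolding q_def using hom_word_eval_subst[where h = w and e = e, OF FG.is_group is_group word_eval_hom[OF incl] xFG wFG] xG
    by simp
  then show ?thesis using one qFG \<open>q \<noteq> []\<close> by auto
qed

text \<open>If the rank increased, then a basis of \<open>K\<close> together with \<open>x\<close> would generate
  \<open>\<langle>K, x\<rangle>\<close> with as many elements as a basis of it has. Any map of these generators to a finite
  group would extend to a homomorphism, so the relation coming from the equation would be a law of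
  all finite groups.\<close>

lemma adjoin_solution_rank:
  assumes B: "free_basis G B" and T: "finite T" "T \<subseteq> carrier G" "K = generate G T"
    and sol: "solution_over G K e x"
  shows "\<exists>T'. finite T' \<and> card T' \<le> card T \<and> T' \<subseteq> carrier G \<and> generate G (insert x K) = generate G T'"
proof -
  have K: "subgroup K G" unfolding T(3) by (rule generate_is_subgroup[OF T(2)])
  have xG: "x \<in> carrier G" using sol by (simp add: solution_over_def)
  show ?thesis
  proof (cases "x \<in> K")
    case True
    then have "generate G (insert x K) = K"
      using generate_subgroup_incl[OF _ K, of "insert x K"] generate.incl[of _ "insert x K" G] by auto
    then show ?thesis using T by auto
  next
    case False
    interpret K: group "G\<lparr>carrier := K\<rparr>" using subgroup_imp_group[OF K] .
    obtain A where A: "free_basis (G\<lparr>carrier := K\<rparr>) A" using nielsen_schreier[OF B K] by blast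
    have TK: "T \<subseteq> K" unfolding T(3) by (intro subsetI generate.incl)
    have AK: "A \<subseteq> K" and genA: "generate G A = K"
      using K.free_basisD(1,2)[OF A] generate_consistent[OF _ K] by auto
    have AT: "finite A" "card A \<le> card T"
      using K.finite_free_basis[OF A T(1)] TK generate_consistent[OF TK K] T(3) by auto
    define S where "S = insert x A"
    define K' where "K' = generate G (insert x K)"
    have sub: "insert x K \<subseteq> carrier G" "S \<subseteq> carrier G"
      using xG AK subgroup.subset[OF K] by (auto simp: S_def)
    have K': "subgroup K' G" unfolding K'_def by (rule generate_is_subgroup[OF sub(1)])
    have "K \<subseteq> generate G S" using mono_generate[of A S] genA by (auto simp: S_def)
    then have "insert x K \<subseteq> generate G S" using generate.incl[of x S G] by (auto simp: S_def)
    then have "K' \<subseteq> generate G S" unfolding K'_def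
      by (rule generate_subgroup_incl[OF _ generate_is_subgroup[OF sub(2)]])
    moreover have "generate G S \<subseteq> K'"
      unfolding K'_def using AK by (intro mono_generate) (auto simp: S_def)
    ultimately have genS: "generate G S = K'" by blast
    have SK': "S \<subseteq> K'" using genS generate.incl[of _ S G] by blast
    interpret K': group "G\<lparr>carrier := K'\<rparr>" using subgroup_imp_group[OF K'] .
    have genS': "generate (G\<lparr>carrier := K'\<rparr>) S = K'" using generate_consistent[OF SK' K'] genS by simp
    obtain A' where A': "free_basis (G\<lparr>carrier := K'\<rparr>) A'" using nielsen_schreier[OF B K'] by blast
    have "x \<notin> A" using AK False by blast
    then have finS: "finite S" "card S = Suc (card A)" using AT(1) by (simp_all add: S_def)
    have AS: "finite A'" "card A' \<le> card S"
      using K'.finite_free_basis[OF A' finS(1)] SK' genS' by auto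
    have A'K': "A' \<subseteq> K'" and genA': "generate G A' = K'"
      using K'.free_basisD(1,2)[OF A'] generate_consistent[OF _ K'] by auto
    \<comment> \<open>Since \<open>card A' \<le> card S = Suc (card A)\<close> and
      \<open>card A \<le> card T\<close>, only equality has to be excluded.\<close>
    have "card A' \<noteq> card S"
    proof
      assume card: "card A' = card S"
      obtain q where q: "q \<in> carrier (free_group S)" "q \<noteq> []" "word_eval G (\<lambda>s. s) q = \<one>"
        using solution_relation[OF K A False sol] by (auto simp: S_def)
      obtain G' :: "(nat \<Rightarrow> nat) monoid" and \<phi> where G': "group G'" "finite (carrier G')"
        and \<phi>: "\<And>s. \<phi> s \<in> carrier G'" and ne: "word_eval G' \<phi> q \<noteq> \<one>\<^bsub>G'\<^esub>"
        using free_group_residually_finite[OF q(1,2)] by blast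
      \<comment> \<open>Equal cardinalities allow any map on \<open>S\<close>, in particular one
        under which \<open>q\<close> survives; but \<open>q\<close> is trivial in \<open>K'\<close>,
        so \<open>f\<close> must kill it.\<close>
      obtain f where f: "f \<in> hom (G\<lparr>carrier := K'\<rparr>) G'" "\<And>s. s \<in> S \<Longrightarrow> f s = \<phi> s"
        using K'.generators_extend[OF A' AS(1) finS(1) _ _ card[symmetric] G', of \<phi>] SK' genS' \<phi>
        by auto
      interpret f: group_hom "G\<lparr>carrier := K'\<rparr>" G' f
        using f(1) G'(1) K'.is_group by (simp add: group_hom_def group_hom_axioms_def)
      have qS: "fst ` set q \<subseteq> S" using q(1) by (simp add: carrier_free_group)
      have "word_eval (G\<lparr>carrier := K'\<rparr>) (\<lambda>s. s) q = \<one>"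
        using word_eval_subgroup[OF K', of "\<lambda>s. s" q] qS SK' q(3) by auto
      moreover have "f (word_eval (G\<lparr>carrier := K'\<rparr>) (\<lambda>s. s) q) = word_eval G' f q"
        using hom_word_eval[OF K'.is_group G'(1) f(1), of "\<lambda>s. s" q] qS SK' by auto
      moreover have "word_eval G' f q = word_eval G' \<phi> q"
        using f(2) qS by (intro word_eval_cong) auto
      ultimately show False using ne f.hom_one by simp
    qed
    then have "card A' \<le> card T" using AS finS AT by simp
    then show ?thesis
      using AS(1) A'K' subgroup.subset[OF K'] genA' by (intro exI[of _ A']) (auto simp: K'_def)
  qed
qed

text \<open>The predicate \<open>P\<close> collects what a partial closure must satisfy: it is
  e-algebraic over \<open>H\<close>, has at most \<open>card T\<close> generators, and is forced by
  finitely many equations. A subgroup with \<open>P\<close> that is not closed grows by one solution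
  and keeps \<open>P\<close>; the uniform bound on generators excludes growing forever.\<close>

lemma e_closure_fin_gen:
  assumes B: "free_basis G B" and H: "subgroup H G" and T: "finite T" "T \<subseteq> carrier G" "H = generate G T"
  shows "e_algebraic_ext G H (e_closure G E H) \<and>
    (\<exists>T'. finite T' \<and> card T' \<le> card T \<and> T' \<subseteq> carrier G \<and> e_closure G E H = generate G T') \<and>
    (\<exists>E0. finite E0 \<and> E0 \<subseteq> E \<and> e_closure G E0 H = e_closure G E H)"
proof -
  define P where "P K \<longleftrightarrow> subgroup K G \<and> H \<subseteq> K \<and> e_algebraic_ext G H K \<and>
    (\<exists>T'. finite T' \<and> card T' \<le> card T \<and> T' \<subseteq> carrier G \<and> K = generate G T') \<and>
    (\<exists>E0. finite E0 \<and> E0 \<subseteq> E \<and> K \<subseteq> e_closure G E0 H)" for K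
  have mono: "e_closure G D H \<subseteq> e_closure G D' H" if "D \<subseteq> D'" for D D'
  proof (rule e_closure_least[OF H _ subset_e_closure[OF H]])
    show "e_closed G D (e_closure G D' H)"
      using e_closed_e_closure[OF H, of D'] that unfolding e_closed_def by blast
  qed
  have base: "P H"
    unfolding P_def
  proof (intro conjI)
    show "e_algebraic_ext G H H"
      unfolding e_algebraic_ext_def by (intro exI[of _ "0 :: nat"] exI[of _ "\<lambda>_. H"]) simp
    show "\<exists>T'. finite T' \<and> card T' \<le> card T \<and> T' \<subseteq> carrier G \<and> H = generate G T'"
      using T by blast
    show "\<exists>E0. finite E0 \<and> E0 \<subseteq> E \<and> H \<subseteq> e_closure G E0 H"
      by (rule exI[of _ "{}"]) (simp add: subset_e_closure[OF H])
  qed (simp_all add: H)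
  have step: "\<exists>K'. P K' \<and> K \<subset> K'" if P: "P K" and nc: "\<not> e_closed G E K" for K
  proof -
    have K: "subgroup K G" "H \<subseteq> K" "e_algebraic_ext G H K" using P by (simp_all add: P_def)
    obtain T1 where T1: "finite T1" "card T1 \<le> card T" "T1 \<subseteq> carrier G" "K = generate G T1"
      using P unfolding P_def by blast
    obtain E0 where E0: "finite E0" "E0 \<subseteq> E" "K \<subseteq> e_closure G E0 H"
      using P unfolding P_def by blast
    obtain e x where ex: "e \<in> E" "solution_over G K e x" "x \<notin> K"
      using nc K(1) unfolding e_closed_def by blast
    define K' where "K' = generate G (insert x K)"
    have sub: "insert x K \<subseteq> carrier G" using ex(2) subgroup.subset[OF K(1)] by (auto simp: solution_over_def)
    have K': "subgroup K' G" unfolding K'_def by (rule generate_is_subgroup[OF sub])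
    have inc: "insert x K \<subseteq> K'" unfolding K'_def by (intro subsetI generate.incl)
    have "algebraic_ext G K K'" unfolding K'_def by (rule algebraic_adjoin_solution[OF B K(1) ex(2)])
    moreover have "elementary_ext G K K'"
      using K(1) K' inc unfolding elementary_ext_def extension_def by (auto simp: K'_def)
    ultimately have e_alg: "e_algebraic_ext G H K'" using e_algebraic_ext_step[OF K(3)] by blast
    obtain T2 where T2: "finite T2" "card T2 \<le> card T1" "T2 \<subseteq> carrier G" "K' = generate G T2"
      using adjoin_solution_rank[OF B T1(1,3,4) ex(2)] unfolding K'_def by blast
    \<comment> \<open>The solution x was found over \<open>K\<close>, but by monotonicity it is also
      one over the closure for \<open>insert e E0\<close>, which contains \<open>K\<close>.\<close>
    have K'C: "K' \<subseteq> e_closure G (insert e E0) H"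
    proof -
      let ?C = "e_closure G (insert e E0) H"
      have C: "subgroup ?C G" "\<And>x. solution_over G ?C e x \<Longrightarrow> x \<in> ?C"
        using e_closed_e_closure[OF H, of "insert e E0"] by (auto simp: e_closed_def)
      have KC: "K \<subseteq> ?C" using E0(3) mono[of E0 "insert e E0"] by blast
      have "x \<in> ?C" by (rule C(2)[OF solution_over_mono[OF K(1) C(1) KC ex(2)]])
      then show ?thesis unfolding K'_def using KC by (intro generate_subgroup_incl C(1)) auto
    qed
    have "P K'" unfolding P_def
    proof (intro conjI)
      show "subgroup K' G" by (rule K')
      show "H \<subseteq> K'" using inc K(2) by blast
      show "\<exists>T'. finite T' \<and> card T' \<le> card T \<and> T' \<subseteq> carrier G \<and> K' = generate G T'"
        using T2 T1(2) le_trans by blast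
      show "\<exists>E0. finite E0 \<and> E0 \<subseteq> E \<and> K' \<subseteq> e_closure G E0 H"
        using E0(1,2) ex(1) K'C by (intro exI[of _ "insert e E0"]) simp
    qed (rule e_alg)
    then show ?thesis using inc ex(3) by blast
  qed
  have "\<exists>K. P K \<and> e_closed G E K"
  proof (rule ccontr)
    assume "\<not> ?thesis"
    then have ex: "\<exists>K'. P K' \<and> K \<subset> K'" if "P K" for K using step[OF that] that by blast
    have "\<exists>C. \<forall>i. P (C i) \<and> C i \<subset> C (Suc i)"
    proof (rule dependent_nat_choice)
      show "\<exists>K. P K" using base by (rule exI)
    qed (rule ex)
    then obtain C where C: "\<And>i. P (C i)" "\<And>i. C i \<subset> C (Suc i)" by blast
    show False
    proof (rule bounded_rank_chain[where K = C, OF B _ C(2)])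
      show "subgroup (C i) G" for i using C(1)[of i] unfolding P_def by (rule conjunct1)
      show "\<exists>T'. finite T' \<and> card T' \<le> card T \<and> T' \<subseteq> carrier G \<and> C i = generate G T'" for i
        using C(1)[of i] unfolding P_def by (elim conjE)
    qed
  qed
  then obtain K where K: "P K" "e_closed G E K" by blast
  obtain E0 where E0: "finite E0" "E0 \<subseteq> E" "K \<subseteq> e_closure G E0 H"
    using K(1) unfolding P_def by blast
  \<comment> \<open>This closes a circle of inclusions: the closure for \<open>E\<close> lies in
    \<open>K\<close>, which lies in the closure for \<open>E0\<close>, which lies in the closure for
    \<open>E\<close>.\<close>
  have "e_closure G E H \<subseteq> K" 
    using K(1) unfolding P_def by (intro e_closure_least[OF H K(2)]) (elim conjE)
  then have "K = e_closure G E H" "e_closure G E0 H = e_closure G E H" using E0 mono[OF E0(2)] by auto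
  then show ?thesis using K(1) E0(1,2) unfolding P_def by blast
qed

end

theorem corollary4p12:
  fixes F :: "('a, 'b) monoid_scheme" and H :: "'a set" and E :: "equation set"
  assumes "is_free_group F"
    and "subgroup H F"
    and "E \<subseteq> equations"
  shows "(e_closed F E (e_closure F E H) \<and> H \<subseteq> e_closure F E H \<and>
          (\<forall>K. e_closed F E K \<and> H \<subseteq> K \<longrightarrow> e_closure F E H \<subseteq> K)) \<and>
         algebraic_ext F H (e_closure F E H) \<and>
         (fin_gen_subgroup F H \<longrightarrow>
            e_algebraic_ext F H (e_closure F E H) \<and>
            free_rank (F\<lparr>carrier := e_closure F E H\<rparr>) \<le>o free_rank (F\<lparr>carrier := H\<rparr>) \<and>
            (\<exists>E0. finite E0 \<and> E0 \<subseteq> E \<and> e_closure F E0 H = e_closure F E H))"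
proof -
  interpret F: group F using assms(1) by (simp add: is_free_group_def)
  obtain B where B: "free_basis F B" using assms(1) by (auto simp: is_free_group_def)
  note H = assms(2)
  let ?C = "e_closure F E H"
  have C: "subgroup ?C F" using F.e_closed_e_closure[OF H, of E] by (simp add: e_closed_def)
  \<comment> \<open>The same choice as in \<open>free_rank\<close>, so the comparison of ranks
    unfolds to one between these bases.\<close>
  define basis where "basis K = (SOME A. free_basis (F\<lparr>carrier := K\<rparr>) A)" for K
  have basis: "free_basis (F\<lparr>carrier := K\<rparr>) (basis K)" if "subgroup K F" for K
    unfolding basis_def by (rule someI_ex[OF F.nielsen_schreier[OF B that]])
  have fin: "finite (basis K) \<and> card (basis K) \<le> card T"
    if "subgroup K F" "finite T" "T \<subseteq> carrier F" "K = generate F T" for K T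
  proof -
    have TK: "T \<subseteq> K" unfolding that(4) by (intro subsetI generate.incl)
    show ?thesis
      using group.finite_free_basis[OF F.subgroup_imp_group[OF that(1)] basis[OF that(1)] that(2)]
        TK F.generate_consistent[OF TK that(1)] that(4) by simp
  qed
  have "e_algebraic_ext F H ?C \<and> free_rank (F\<lparr>carrier := ?C\<rparr>) \<le>o free_rank (F\<lparr>carrier := H\<rparr>) \<and>
      (\<exists>E0. finite E0 \<and> E0 \<subseteq> E \<and> e_closure F E0 H = ?C)" if fg: "fin_gen_subgroup F H"
  proof -
    obtain S where "finite S" "S \<subseteq> carrier F" "H = generate F S" using fg by (auto simp: fin_gen_subgroup_def)
    then have finH: "finite (basis H)" using fin[OF H] by blast
    have gen: "basis H \<subseteq> H" "H = generate F (basis H)"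
      using group.free_basisD(1,2)[OF F.subgroup_imp_group[OF H] basis[OF H]]
        F.generate_consistent[OF _ H] by auto
    then have sub: "basis H \<subseteq> carrier F" using subgroup.subset[OF H] by blast
    \<comment> \<open>A basis of \<open>H\<close> serves as the generating set, which turns the
      bound on generators into the rank of \<open>H\<close>.\<close>
    note fg = F.e_closure_fin_gen[OF B H finH sub gen(2), of E]
    then obtain T where "finite T" "card T \<le> card (basis H)" "T \<subseteq> carrier F" "?C = generate F T" by blast
    then have "|basis ?C| \<le>o |basis H|"
      using fin[OF C, of T] finH by (intro card_of_ordLeq_finite_card) auto
    then have "free_rank (F\<lparr>carrier := ?C\<rparr>) \<le>o free_rank (F\<lparr>carrier := H\<rparr>)"
      by (simp add: free_rank_def basis_def)
    then show ?thesis using fg by blast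
  qed
  then show ?thesis
    using F.e_closed_e_closure[OF H] F.subset_e_closure[OF H] F.e_closure_least[OF H]
      F.algebraic_e_closure[OF B H] by blast
qed

end
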